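(* Let $\alpha<1$, $n\ge1$ and $p>1$. Assume that both $f \in H^1(\mathbf{R}^n)$ and $g\in L^2(\mathbf{R}^n)$ are non-negative, and at least one of them does not vanish identically. Suppose that $u$ is an energy solution of the Cauchy problem on $\mathbf{R}^n \times [0,T)$ that satisfies, for some $R\ge1$, $$\operatorname{supp} u \subset\{(x,t)\in\mathbf{R}^n\times[0,T) \colon |x|\le t+R\}.$$ Then there exists a constant $\varepsilon_0=\varepsilon_0(f,g,R,n,p,\mu_1,\mu_2,\alpha,\beta)>0$ such that $T$ has to satisfy $$T\leq 3 \zeta(C\varepsilon)$$ for $0<\varepsilon\le\varepsilon_0$, where $\zeta=\zeta(\overline{\varepsilon})$ is the larger solution to the equation $$\overline{\varepsilon}\, \zeta^{\frac{2}{p-1}-n+\frac{1+\alpha}{4}}\exp\left(\frac{2}{1-\alpha}\sqrt{ \mu_2 \exp\left(\frac{\mu_1}{1-\beta}\right) }\, \zeta^{\frac{1-\alpha}{2}}\right) = 1,$$ and $C$ is a positive constant independent of $\varepsilon$.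
   Context: Consider the Cauchy problem $$u_{tt} - \Delta u + \frac{\mu_1}{(1+t)^\beta} u_t - \frac{\mu_2}{(1+t)^{\alpha+1}} u = |u|^p \text{ in } \mathbf{R}^n\times(0,T),\qquad u(x,0)=\varepsilon f(x),\ u_t(x,0)=\varepsilon g(x),$$ with $\mu_1\ge0$, $\mu_2>0$, $\alpha<1$, $\beta>1$, $p>1$, $n\in\mathbf{N}$, $T>0$, $\varepsilon>0$ small. An energy solution on $\mathbf{R}^n\times[0,T)$ is $u \in C([0,T), H^1(\mathbf{R}^n)) \cap C^1([0,T),L^2(\mathbf{R}^n)) \cap L^p_{loc}(\mathbf{R}^n \times (0,T))$ with $u(x,0)=\varepsilon f(x)$ in $H^1$, $u_t(x,0)=\varepsilon g(x)$ in $L^2$, and $$\int_{\mathbf{R}^n}u_t(x,t)\phi(x,t)dx-\int_{\mathbf{R}^n}\varepsilon g(x)\phi(x,0)dx+\int_0^t\!\!\int_{\mathbf{R}^n}\{-u_t\phi_t+\nabla u\cdot\nabla\phi\}dxds+\int_0^t\!\!\int_{\mathbf{R}^n}\Big\{\frac{\mu_1}{(1+s)^\beta}u_t-\frac{\mu_2}{(1+s)^{\alpha+1}}u\Big\}\phi\,dxds=\int_0^t\!\!\int_{\mathbf{R}^n}|u|^p\phi\,dxds$$ for all $\phi\in C_0^\infty(\mathbf{R}^n\times[0,T))$ and all $t\in[0,T)$. *)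

theory Defs
  imports "HOL-Analysis.Analysis"
begin

fun Ck :: "nat \<Rightarrow> ('a::real_normed_vector \<Rightarrow> real) \<Rightarrow> bool" where
  "Ck 0 f = continuous_on UNIV f"
| "Ck (Suc k) f = ((\<forall>x. f differentiable (at x)) \<and>
       (\<forall>v. Ck k (\<lambda>x. frechet_derivative f (at x) v)))"

definition smooth :: "('a::real_normed_vector \<Rightarrow> real) \<Rightarrow> bool" where
  "smooth f \<longleftrightarrow> (\<forall>k. Ck k f)"

definition pd :: "('a::real_normed_vector \<Rightarrow> real) \<Rightarrow> 'a \<Rightarrow> 'a \<Rightarrow> real" where
  "pd \<phi> v x = frechet_derivative \<phi> (at x) v"

definition test_fun :: "('a::euclidean_space \<Rightarrow> real) \<Rightarrow> bool" where
  "test_fun \<phi> \<longleftrightarrow> smooth \<phi> \<and> (\<exists>K. compact K \<and> (\<forall>x. x \<notin> K \<longrightarrow> \<phi> x = 0))"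

text \<open>C_0^infinity(R^n x [0,T)): restrictions of smooth functions on R^n x R whose
  support is a compact subset of R^n x (-infinity,T).\<close>
definition test_fun_T :: "real \<Rightarrow> ('a::euclidean_space \<times> real \<Rightarrow> real) \<Rightarrow> bool" where
  "test_fun_T T \<phi> \<longleftrightarrow> smooth \<phi> \<and>
     (\<exists>K. compact K \<and> K \<subseteq> {z. snd z < T} \<and> (\<forall>z. z \<notin> K \<longrightarrow> \<phi> z = 0))"

definition L2 :: "('a::euclidean_space \<Rightarrow> real) \<Rightarrow> bool" where
  "L2 f \<longleftrightarrow> f \<in> borel_measurable lebesgue \<and> integrable lebesgue (\<lambda>x. (f x)^2)"

definition weak_grad :: "('a::euclidean_space \<Rightarrow> real) \<Rightarrow> ('a \<Rightarrow> 'a) \<Rightarrow> bool" where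
  "weak_grad f G \<longleftrightarrow> (\<forall>\<phi>. test_fun \<phi> \<longrightarrow> (\<forall>i\<in>Basis.
      (\<integral>x. f x * pd \<phi> i x \<partial>lebesgue) = - (\<integral>x. (G x \<bullet> i) * \<phi> x \<partial>lebesgue)))"

definition H1_with :: "('a::euclidean_space \<Rightarrow> real) \<Rightarrow> ('a \<Rightarrow> 'a) \<Rightarrow> bool" where
  "H1_with f G \<longleftrightarrow> L2 f \<and> (\<forall>i\<in>Basis. L2 (\<lambda>x. G x \<bullet> i)) \<and> weak_grad f G"

definition H1 :: "('a::euclidean_space \<Rightarrow> real) \<Rightarrow> bool" where
  "H1 f \<longleftrightarrow> (\<exists>G. H1_with f G)"

text \<open>Energy solution of
  u_tt - Laplace u + mu1/(1+t)^beta u_t - mu2/(1+t)^(alpha+1) u = |u|^p,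
  u(0) = eps f, u_t(0) = eps g, on R^n x [0,T).  Here u x t is u(x,t); ut and Du are
  the (L^2-) time derivative and the (weak) spatial gradient.\<close>
definition energy_sol ::
  "real \<Rightarrow> real \<Rightarrow> real \<Rightarrow> real \<Rightarrow> real \<Rightarrow> ('a::euclidean_space \<Rightarrow> real) \<Rightarrow> ('a \<Rightarrow> real)
     \<Rightarrow> real \<Rightarrow> real \<Rightarrow> ('a \<Rightarrow> real \<Rightarrow> real) \<Rightarrow> bool" where
  "energy_sol \<mu>1 \<mu>2 \<alpha> \<beta> p f g \<epsilon> T u \<longleftrightarrow>
   (\<exists>ut Du.
     \<comment> \<open>u in C([0,T), H^1)\<close>
     (\<forall>t\<in>{0..<T}. H1_with (\<lambda>x. u x t) (\<lambda>x. Du x t)) \<and>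
     (\<forall>t\<in>{0..<T}. ((\<lambda>s. \<integral>x. (u x s - u x t)^2 + (norm (Du x s - Du x t))^2 \<partial>lebesgue)
                      \<longlongrightarrow> 0) (at t within {0..<T})) \<and>
     \<comment> \<open>u in C^1([0,T), L^2) with derivative ut\<close>
     (\<forall>t\<in>{0..<T}. L2 (\<lambda>x. ut x t)) \<and>
     (\<forall>t\<in>{0..<T}. ((\<lambda>s. \<integral>x. ((u x s - u x t) / (s - t) - ut x t)^2 \<partial>lebesgue)
                      \<longlongrightarrow> 0) (at t within {0..<T})) \<and>
     (\<forall>t\<in>{0..<T}. ((\<lambda>s. \<integral>x. (ut x s - ut x t)^2 \<partial>lebesgue)
                      \<longlongrightarrow> 0) (at t within {0..<T})) \<and>
     \<comment> \<open>u in L^p_loc(R^n x (0,T))\<close>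
     (\<forall>K. compact K \<and> K \<subseteq> UNIV \<times> {0<..<T} \<longrightarrow>
          set_integrable lebesgue K (\<lambda>z. \<bar>u (fst z) (snd z)\<bar> powr p)) \<and>
     \<comment> \<open>initial data (equality in H^1 resp. L^2)\<close>
     (AE x in lebesgue. u x 0 = \<epsilon> * f x) \<and>
     (AE x in lebesgue. ut x 0 = \<epsilon> * g x) \<and>
     \<comment> \<open>weak formulation\<close>
     (\<forall>\<phi> t. test_fun_T T \<phi> \<and> t \<in> {0..<T} \<longrightarrow>
        (\<integral>x. ut x t * \<phi> (x, t) \<partial>lebesgue)
        - (\<integral>x. \<epsilon> * g x * \<phi> (x, 0) \<partial>lebesgue)
        + (LINT s:{0..t}|lborel. \<integral>x. - ut x s * pd \<phi> (0, 1) (x, s)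
             + (\<Sum>i\<in>Basis. (Du x s \<bullet> i) * pd \<phi> (i, 0) (x, s)) \<partial>lebesgue)
        + (LINT s:{0..t}|lborel. \<integral>x. (\<mu>1 / (1 + s) powr \<beta> * ut x s
             - \<mu>2 / (1 + s) powr (\<alpha> + 1) * u x s) * \<phi> (x, s) \<partial>lebesgue)
        = (LINT s:{0..t}|lborel. \<integral>x. \<bar>u x s\<bar> powr p * \<phi> (x, s) \<partial>lebesgue)))"

definition zeta :: "nat \<Rightarrow> real \<Rightarrow> real \<Rightarrow> real \<Rightarrow> real \<Rightarrow> real \<Rightarrow> real \<Rightarrow> real" where
  "zeta n p \<mu>1 \<mu>2 \<alpha> \<beta> eb = (GREATEST z. z > 0 \<and>
     eb * z powr (2 / (p - 1) - real n + (1 + \<alpha>) / 4)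
        * exp (2 / (1 - \<alpha>) * sqrt (\<mu>2 * exp (\<mu>1 / (1 - \<beta>))) * z powr ((1 - \<alpha>) / 2)) = 1)"

end

theory Submission
  imports Defs "HOL-Real_Asymp.Real_Asymp"
begin

text \<open>
  Testing the weak formulation with a function equal to 1 on the (compact) support of \<open>u\<close> shows that
  the mass \<open>U(t) = \<integral> u(x,t) dx\<close> satisfies
  \<open>U'' + \<mu>1 (1+t)^(-\<beta>) U' \<ge> \<mu>2 (1+t)^(-\<alpha>-1) U + \<kappa> (t+R)^(-n(p-1)) \<bar>U\<bar>^p\<close>; the power comes from
  Jensen's inequality on the ball of radius \<open>t + R\<close>. A first-crossing argument compares \<open>U\<close> with
  explicit subsolutions. With \<open>\<gamma> = (1-\<alpha>)/2\<close> and \<open>c\<close> the constant in the definition of \<open>\<zeta>\<close>, the function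
  \<open>exp (\<nu> c (1+t)\<^sup>\<gamma>)\<close> is a subsolution of the linear part at large times for every \<open>\<nu> < 1\<close>. Choosing
  \<open>\<nu> 2\<^sup>\<gamma> > 1\<close>, at time \<open>2\<zeta>\<close> the mass exceeds \<open>\<epsilon> exp (c \<zeta>\<^sup>\<gamma>)\<close> by a factor that is exponentially large
  in \<open>\<zeta>\<^sup>\<gamma>\<close>. This beats every power of \<open>\<zeta>\<close>, so the comparison function
  \<open>Y (1 - (t-2\<zeta>)/\<zeta>)^(-2/(p-1))\<close> forces blow-up before \<open>3\<zeta>\<close>. Because of this room one may take \<open>C = 1\<close>.
\<close>

section \<open>Smooth cutoff functions\<close>

text \<open>The rate comes from a WKB heuristic for \<open>W'' + b W' = q W\<close>: as \<beta> > 1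
  makes \<open>b\<close> integrable in time, growth is governed by the exponential of the integral
  of sqrt \<open>q\<close>, that is by (2 sqrt \<mu>2 / (1 - \<alpha>)) t^((1 - \<alpha>)/2). The
  constant in \<open>zeta\<close> has \<mu>2 exp (\<mu>1 / (1 - \<beta>)) <= \<mu>2 in place of
  \<mu>2. For \<mu>1 = 0 the two coincide, and the lower-order terms, whose sign varies with
  \<alpha>, cannot be absorbed; hence the factor \<nu> < 1. What it costs is recovered because the
  exponent at 2\<zeta> is 2^\<gamma> times the one at \<zeta>. The other obstacle is regularity. The
  derivative of the mass is merely continuous, u_t and the gradient are L2 objects without pointwise
  support information, and the power of u is only integrable locally in positive times, so that
  single time slices may fail to be integrable. The comparison argument therefore works with
  increments of the derivative between positive times.\<close>

lemma Ck_const: "Ck k (\<lambda>x. c)"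
proof (induction k arbitrary: c)
  case (Suc k)
  then show ?case by simp
qed simp

lemma Ck_Suc_D: "Ck (Suc k) f \<Longrightarrow> Ck k f"
proof (induction k arbitrary: f)
  case 0
  then show ?case
    by (auto intro!: continuous_at_imp_continuous_on differentiable_imp_continuous_within)
next
  case (Suc k)
  have "f differentiable at x" for x
    using Suc.prems by simp
  moreover have "Ck k (\<lambda>x. frechet_derivative f (at x) v)" for v
    using Suc.prems by (intro Suc.IH) simp
  ultimately show ?case by simp
qed

lemma Ck_add: "Ck k f \<Longrightarrow> Ck k g \<Longrightarrow> Ck k (\<lambda>x. f x + g x)"
proof (induction k arbitrary: f g)
  case 0
  then show ?case by (auto intro!: continuous_intros)
next
  case (Suc k)
  have "frechet_derivative (\<lambda>x. f x + g x) (at x) =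
      (\<lambda>v. frechet_derivative f (at x) v + frechet_derivative g (at x) v)" for x
    using Suc.prems
    by (intro frechet_derivative_at[symmetric] has_derivative_add)
       (auto simp: frechet_derivative_works[symmetric])
  then show ?case using Suc by (auto intro: differentiable_add)
qed

lemma Ck_mult: "Ck k f \<Longrightarrow> Ck k g \<Longrightarrow> Ck k (\<lambda>x. f x * g x)"
proof (induction k arbitrary: f g)
  case 0
  then show ?case by (auto intro!: continuous_intros)
next
  case (Suc k)
  have "frechet_derivative (\<lambda>x. f x * g x) (at x) =
      (\<lambda>v. f x * frechet_derivative g (at x) v + frechet_derivative f (at x) v * g x)" for x
    using Suc.prems
    by (intro frechet_derivative_at[symmetric] has_derivative_mult)
       (auto simp: frechet_derivative_works[symmetric])
  moreover have "Ck k (\<lambda>x. f x * frechet_derivative g (at x) v + frechet_derivative f (at x) v * g x)" for v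
  proof (intro Ck_add Suc.IH)
    show "Ck k f" "Ck k g" by (rule Ck_Suc_D, rule Suc.prems)+
  qed (use Suc.prems in simp_all)
  ultimately show ?case using Suc.prems by (auto intro: differentiable_mult)
qed

lemma Ck_bounded_linear: "bounded_linear f \<Longrightarrow> Ck k f"
proof (cases k)
  case 0
  assume "bounded_linear f"
  then show ?thesis using 0 by (simp add: linear_continuous_on)
next
  case (Suc m)
  assume f: "bounded_linear f"
  have "frechet_derivative f (at x) = f" for x
    using bounded_linear_imp_has_derivative[OF f] by (metis frechet_derivative_at)
  then show ?thesis using Suc f Ck_const
    by (auto intro: bounded_linear_imp_differentiable)
qed

text \<open>\<open>Ck\<close> is a predicate on real-valued functions, so a chain rule for general
  inner maps has no direct phrasing. Two cases cover all the cutoffs: an outer function of one real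
  variable here, and a linear inner map in \<open>Ck_compose_linear\<close>.\<close>

lemma Ck_compose:
  fixes g :: "real \<Rightarrow> real"
  shows "Ck k g \<Longrightarrow> Ck k f \<Longrightarrow> Ck k (\<lambda>x. g (f x))"
proof (induction k arbitrary: f g)
  case 0
  then show ?case by (auto intro: continuous_on_compose2)
next
  case (Suc k)
  have g: "(g has_real_derivative frechet_derivative g (at y) 1) (at y)" for y
  proof -
    have D: "(g has_derivative frechet_derivative g (at y)) (at y)"
      using Suc.prems(1) by (simp add: frechet_derivative_works)
    have "frechet_derivative g (at y) v = frechet_derivative g (at y) 1 * v" for v
      using linear_scale[OF has_derivative_linear[OF D], of v 1] by simp
    then show ?thesis
      using D unfolding has_field_derivative_def by (metis ext)
  qed
  have f: "(f has_derivative frechet_derivative f (at x)) (at x)" for x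
    using Suc.prems(2) by (simp add: frechet_derivative_works)
  have D: "((\<lambda>x. g (f x)) has_derivative
      (\<lambda>v. frechet_derivative g (at (f x)) 1 * frechet_derivative f (at x) v)) (at x)" for x
    using has_derivative_compose[OF f[of x] g[of "f x", unfolded has_field_derivative_def]] .
  have "Ck k (\<lambda>x. frechet_derivative g (at (f x)) 1 * frechet_derivative f (at x) v)" for v
  proof (intro Ck_mult Suc.IH[of "\<lambda>y. frechet_derivative g (at y) 1" f])
    show "Ck k f" by (rule Ck_Suc_D, rule Suc.prems)
  qed (use Suc.prems in simp_all)
  then show ?case
    using D by (auto simp: frechet_derivative_at[OF D, symmetric] intro: differentiableI)
qed

lemma Ck_compose_linear:
  assumes L: "bounded_linear L"
  shows "Ck k f \<Longrightarrow> Ck k (\<lambda>x. f (L x))"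
proof (induction k arbitrary: f)
  case 0
  then show ?case by (auto intro: continuous_on_compose2 linear_continuous_on[OF L])
next
  case (Suc k)
  have f: "(f has_derivative frechet_derivative f (at x)) (at x)" for x
    using Suc.prems by (simp add: frechet_derivative_works)
  have D: "((\<lambda>x. f (L x)) has_derivative (\<lambda>v. frechet_derivative f (at (L x)) (L v))) (at x)" for x
    using has_derivative_compose[OF bounded_linear_imp_has_derivative[OF L] f] .
  have "Ck k (\<lambda>x. frechet_derivative f (at (L x)) (L v))" for v
    using Suc.prems by (intro Suc.IH[of "\<lambda>y. frechet_derivative f (at y) (L v)"]) simp
  then show ?case
    using D by (auto simp: frechet_derivative_at[OF D, symmetric] intro: differentiableI)
qed

lemma Ck_inverse: "Ck k f \<Longrightarrow> (\<And>x. f x \<noteq> 0) \<Longrightarrow> Ck k (\<lambda>x. inverse (f x))"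
proof (induction k)
  case 0
  then show ?case by (auto intro!: continuous_intros)
next
  case (Suc k)
  have D: "((\<lambda>x. inverse (f x)) has_derivative
      (\<lambda>v. - (inverse (f x) * frechet_derivative f (at x) v * inverse (f x)))) (at x)" for x
    using Suc.prems by (intro Deriv.has_derivative_inverse) (auto simp: frechet_derivative_works)
  have "Ck k (\<lambda>x. (-1) * (inverse (f x) * frechet_derivative f (at x) v * inverse (f x)))" for v
  proof -
    have "Ck k (\<lambda>x. inverse (f x))"
      by (rule Suc.IH[OF Ck_Suc_D[OF Suc.prems(1)] Suc.prems(2)])
    moreover have "Ck k (\<lambda>x. frechet_derivative f (at x) v)"
      using Suc.prems(1) by simp
    ultimately show ?thesis by (intro Ck_mult Ck_const)
  qed
  then show ?case
    using D by (auto simp: frechet_derivative_at[OF D, symmetric] intro: differentiableI)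
qed

lemma smooth_inner_self: "smooth (\<lambda>x::'a::euclidean_space. x \<bullet> x)"
  unfolding smooth_def
proof
  fix k
  show "Ck k (\<lambda>x::'a. x \<bullet> x)"
  proof (cases k)
    case 0
    then show ?thesis by (auto intro!: continuous_intros)
  next
    case (Suc m)
    have D: "((\<lambda>x. x \<bullet> x) has_derivative (\<lambda>v. x \<bullet> v + v \<bullet> x)) (at x)" for x :: 'a
      by (rule derivative_eq_intros refl)+
    have "Ck m (\<lambda>x::'a. x \<bullet> v + v \<bullet> x)" for v
      by (intro Ck_bounded_linear bounded_linear_add bounded_linear_inner_left bounded_linear_inner_right)
    then show ?thesis
      using D Suc by (auto simp: frechet_derivative_at[OF D, symmetric] intro: differentiableI)
  qed
qed

text \<open>The classical flat function exp (-1/x) with its multiples by powers of 1/x. The whole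
  family is introduced because differentiation stays in its linear span
  (\<open>exp_bump_derivative\<close>), so that smoothness follows by induction on the order for all
  \<open>n\<close> at once.\<close>

definition exp_bump :: "nat \<Rightarrow> real \<Rightarrow> real" where
  "exp_bump n x = (if x > 0 then inverse x ^ n * exp (- inverse x) else 0)"

lemma exp_bump_tendsto_0: "(exp_bump n \<longlongrightarrow> 0) (at 0)"
proof -
  have "((\<lambda>x::real. inverse x ^ n / exp (inverse x)) \<longlongrightarrow> 0) (at_right 0)"
    by (rule filterlim_compose[OF tendsto_power_div_exp_0 filterlim_inverse_at_top_right])
  then have "(exp_bump n \<longlongrightarrow> 0) (at_right 0)"
    by (rule Lim_transform_eventually)
       (auto simp: eventually_at_filter exp_bump_def exp_minus divide_inverse)
  moreover have "(exp_bump n \<longlongrightarrow> 0) (at_left 0)"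
    by (rule Lim_transform_eventually[OF tendsto_const])
       (auto simp: eventually_at_filter exp_bump_def)
  ultimately show ?thesis by (simp add: filterlim_split_at)
qed

lemma exp_bump_derivative:
  "(exp_bump n has_real_derivative exp_bump (n + 2) x - real n * exp_bump (n + 1) x) (at x)"
proof -
  consider "x < 0" | "x = 0" | "x > 0" by linarith
  then show ?thesis
  proof cases
    case 1
    have "((\<lambda>_. 0) has_real_derivative 0) (at x)" by simp
    then have "(exp_bump n has_real_derivative 0) (at x)"
      by (rule has_field_derivative_transform_within_open[where S = "{..<0}"])
         (use 1 in \<open>auto simp: exp_bump_def\<close>)
    then show ?thesis using 1 by (simp add: exp_bump_def)
  next
    case 2
    \<comment> \<open>The difference quotient of member \<open>n\<close> at 0 is member
      \<open>n + 1\<close>, whose limit is already known.\<close>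
    have "((\<lambda>y. exp_bump n y / y) \<longlongrightarrow> 0) (at 0)"
      by (rule Lim_transform_eventually[OF exp_bump_tendsto_0[of "n + 1"]])
         (auto simp: exp_bump_def eventually_at_filter divide_inverse)
    then show ?thesis
      using 2 by (simp add: DERIV_def) (simp add: exp_bump_def)
  next
    case 3
    have "((\<lambda>x. inverse x ^ n * exp (- inverse x)) has_real_derivative
        inverse x ^ n * (exp (- inverse x) * (inverse x * inverse x))
        + real n * inverse x ^ (n - 1) * (- (inverse x * inverse x)) * exp (- inverse x)) (at x)"
      using 3 by (auto intro!: derivative_eq_intros)
    also have "inverse x ^ n * (exp (- inverse x) * (inverse x * inverse x))
        + real n * inverse x ^ (n - 1) * (- (inverse x * inverse x)) * exp (- inverse x)
      = exp_bump (n + 2) x - real n * exp_bump (n + 1) x"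
      using 3 by (cases n) (simp_all add: exp_bump_def algebra_simps)
    finally have "((\<lambda>x. inverse x ^ n * exp (- inverse x)) has_real_derivative
        exp_bump (n + 2) x - real n * exp_bump (n + 1) x) (at x)" .
    then show ?thesis
      by (rule has_field_derivative_transform_within_open[where S = "{0<..}"])
         (use 3 in \<open>simp_all add: exp_bump_def\<close>)
  qed
qed

lemma Ck_exp_bump: "Ck k (exp_bump n)"
proof (induction k arbitrary: n)
  case 0
  show ?case
    using DERIV_isCont[OF exp_bump_derivative] by (auto intro!: continuous_at_imp_continuous_on)
next
  case (Suc k)
  have D: "(exp_bump n has_derivative
      (\<lambda>v. (exp_bump (n + 2) x + (- real n) * exp_bump (n + 1) x) * v)) (at x)" for x
  proof -
    have "(exp_bump n has_real_derivative exp_bump (n + 2) x + (- real n) * exp_bump (n + 1) x) (at x)"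
      using exp_bump_derivative[of n x] by simp
    then show ?thesis by (simp only: has_field_derivative_def)
  qed
  have "Ck k (\<lambda>x. (exp_bump (n + 2) x + (- real n) * exp_bump (n + 1) x) * v)" for v
    by (intro Ck_mult Ck_add Ck_const Suc.IH)
  then show ?case
    using D by (auto simp: frechet_derivative_at[OF D, symmetric] intro: differentiableI)
qed

lemma ex_smooth_step:
  fixes a b :: real
  assumes "a < b"
  shows "\<exists>\<theta>. smooth \<theta> \<and> (\<forall>x\<le>a. \<theta> x = (1::real)) \<and> (\<forall>x\<ge>b. \<theta> x = 0)"
proof -
  \<comment> \<open>From \<open>b\<close> on the numerator vanishes, up to \<open>a\<close> the
    second summand of the denominator does, and a < b keeps at least one summand positive
    everywhere. Differences are spelled as sums to fit the closure rules for sums and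
    products.\<close>
  define \<theta> where "\<theta> x = exp_bump 0 (b + (-1) * x) * inverse (exp_bump 0 (b + (-1) * x) + exp_bump 0 (x + (- a)))" for x
  have id: "Ck k (\<lambda>x::real. x)" for k
    by (intro Ck_bounded_linear bounded_linear_ident)
  have nz: "exp_bump 0 (b + (-1) * x) + exp_bump 0 (x + (- a)) \<noteq> 0" for x
  proof -
    have "exp_bump 0 y \<ge> 0" "y > 0 \<Longrightarrow> exp_bump 0 y > 0" for y
      by (simp_all add: exp_bump_def)
    then show ?thesis using assms by (smt (verit, best))
  qed
  have "smooth \<theta>"
    unfolding smooth_def \<theta>_def
    by (intro allI Ck_mult Ck_inverse Ck_add Ck_compose[OF Ck_exp_bump] Ck_const id nz)
  moreover have "\<forall>x\<le>a. \<theta> x = 1" "\<forall>x\<ge>b. \<theta> x = 0"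
    using assms by (auto simp: \<theta>_def exp_bump_def)
  ultimately show ?thesis by blast
qed

lemma smooth_continuous: "smooth f \<Longrightarrow> continuous_on UNIV f"
  unfolding smooth_def by (metis Ck.simps(1))

lemma smooth_differentiable: "smooth f \<Longrightarrow> f differentiable (at x)"
  unfolding smooth_def by (metis Ck.simps(2))

lemma smooth_pd: "smooth f \<Longrightarrow> smooth (pd f v)"
  unfolding smooth_def pd_def by (metis Ck.simps(2))

lemma smooth_mult: "smooth f \<Longrightarrow> smooth g \<Longrightarrow> smooth (\<lambda>x. f x * g x)"
  by (simp add: smooth_def Ck_mult)

lemma smooth_compose_linear: "bounded_linear L \<Longrightarrow> smooth f \<Longrightarrow> smooth (\<lambda>x. f (L x))"
  by (simp add: smooth_def Ck_compose_linear)

lemma pd_eq_0_on_open: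
  assumes "open S" "\<And>x. x \<in> S \<Longrightarrow> f x = c" "x \<in> S"
  shows "pd f v x = 0"
proof -
  have "(f has_derivative (\<lambda>v. 0)) (at x)"
    by (rule has_derivative_transform_within_open[OF has_derivative_const[of c]]) (use assms in auto)
  then show ?thesis by (simp add: pd_def frechet_derivative_at[symmetric])
qed

text \<open>The one-dimensional step is applied to the square of the norm, since the norm itself is
  not differentiable at the origin; hence the thresholds r^2 and (r + 1)^2.\<close>

lemma ex_spatial_cutoff:
  assumes "r > 0"
  shows "\<exists>X::'a::euclidean_space \<Rightarrow> real. smooth X \<and> (\<forall>x\<in>cball 0 r. X x = 1)
     \<and> (\<forall>x. x \<notin> cball 0 (r + 1) \<longrightarrow> X x = 0)"
proof -
  have "r^2 < (r + 1)^2" using assms by (simp add: power2_eq_square algebra_simps)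
  then obtain \<theta> where \<theta>: "smooth \<theta>" "\<And>x. x \<le> r^2 \<Longrightarrow> \<theta> x = (1::real)" "\<And>x. x \<ge> (r + 1)^2 \<Longrightarrow> \<theta> x = 0"
    using ex_smooth_step by blast
  have "smooth (\<lambda>x::'a. \<theta> (x \<bullet> x))"
    using \<theta>(1) smooth_inner_self[where 'a = 'a] Ck_compose[of _ \<theta> "\<lambda>x::'a. x \<bullet> x"]
    unfolding smooth_def by simp
  moreover have "\<theta> (x \<bullet> x) = 1" if "x \<in> cball 0 r" for x :: 'a
    using that assms by (intro \<theta>(2)) (simp add: power2_norm_eq_inner[symmetric] power_mono)
  moreover have "\<theta> (x \<bullet> x) = 0" if "x \<notin> cball 0 (r + 1)" for x :: 'a
    using that assms by (intro \<theta>(3)) (simp add: power2_norm_eq_inner[symmetric] power_mono)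
  ultimately show ?thesis by blast
qed

lemma ex_temporal_cutoff:
  fixes a b c d :: real
  assumes "a < b" "b < c" "c < d"
  shows "\<exists>\<tau>. smooth \<tau> \<and> (\<forall>x\<in>{b..c}. \<tau> x = (1::real)) \<and> (\<forall>x. x \<notin> {a..d} \<longrightarrow> \<tau> x = 0)"
proof -
  obtain \<theta> where \<theta>: "smooth \<theta>" "\<And>x. x \<le> c \<Longrightarrow> \<theta> x = (1::real)" "\<And>x. x \<ge> d \<Longrightarrow> \<theta> x = 0"
    using ex_smooth_step[OF assms(3)] by blast
  obtain \<xi> where \<xi>: "smooth \<xi>" "\<And>x. x \<le> - b \<Longrightarrow> \<xi> x = (1::real)" "\<And>x. x \<ge> - a \<Longrightarrow> \<xi> x = 0"
    using ex_smooth_step[of "- b" "- a"] assms by auto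
  have "smooth (\<lambda>x. \<xi> (- x))"
    by (rule smooth_compose_linear[OF _ \<xi>(1)]) (intro bounded_linear_minus bounded_linear_ident)
  then have "smooth (\<lambda>x. \<theta> x * \<xi> (- x))" by (rule smooth_mult[OF \<theta>(1)])
  moreover have "\<forall>x\<in>{b..c}. \<theta> x * \<xi> (- x) = 1" using \<theta> \<xi> by auto
  moreover have "\<theta> x * \<xi> (- x) = 0" if "x \<notin> {a..d}" for x
    using that \<theta>(3)[of x] \<xi>(3)[of "- x"] by auto
  ultimately show ?thesis by blast
qed

section \<open>The differential inequality\<close>

text \<open>The inequality \<open>U'' + b U' \<ge> F(t,U)\<close> in integrated form, as \<open>U' = A\<close> is only continuous.\<close>

definition ode_super :: "real \<Rightarrow> (real \<Rightarrow> real) \<Rightarrow> (real \<Rightarrow> real \<Rightarrow> real) \<Rightarrow> (real \<Rightarrow> real) \<Rightarrow> (real \<Rightarrow> real) \<Rightarrow> bool" where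
  "ode_super T b F U A \<longleftrightarrow>
     (\<forall>t\<in>{0..<T}. (U has_real_derivative A t) (at t within {0..<T})) \<and>
     continuous_on {0..<T} A \<and>
     (\<forall>s t. 0 < s \<and> s < t \<and> t < T \<longrightarrow> integral {s..t} (\<lambda>r. F r (U r) - b r * A r) \<le> A t - A s)"

lemma ode_super_continuous:
  assumes "ode_super T b F U A"
  shows "continuous_on {0..<T} U"
  using assms unfolding ode_super_def continuous_on_eq_continuous_within
  by (auto intro: DERIV_continuous)

text \<open>The crossing is sought for the derivatives. Before the first time t' at which
  \<open>A - w'\<close> fails to be positive, \<open>U - w\<close> increases strictly, so
  \<open>U > w\<close> at t'. Strict monotonicity of \<open>F\<close> and the favourable sign of the
  damping then make \<open>A - w'\<close> nondecreasing just before t', although it falls there from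
  positive to nonpositive values. This is why strictness is required of the initial slope
  only.\<close>

lemma ode_super_comparison:
  fixes U A w w' w'' b :: "real \<Rightarrow> real" and F :: "real \<Rightarrow> real \<Rightarrow> real"
  assumes sup: "ode_super T b F U A"
    and contF: "continuous_on ({0..} \<times> UNIV) (\<lambda>(t, y). F t y)"
    and contb: "continuous_on {0..} b"
    and b: "\<And>t. 0 \<le> t \<Longrightarrow> 0 \<le> b t"
    and mono: "\<And>t x y. 0 \<le> t \<Longrightarrow> 0 \<le> x \<Longrightarrow> x < y \<Longrightarrow> F t x < F t y"
    and w: "\<And>t. t \<in> {a..<c} \<Longrightarrow> (w has_real_derivative w' t) (at t)"
    and w': "\<And>t. t \<in> {a..<c} \<Longrightarrow> (w' has_real_derivative w'' t) (at t)"
    and w_nonneg: "\<And>t. t \<in> {a..<c} \<Longrightarrow> 0 \<le> w t"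
    and sub: "\<And>t. t \<in> {a..<c} \<Longrightarrow> w'' t + b t * w' t \<le> F t (w t)"
    and a: "0 \<le> a" "c \<le> T"
    and init: "w a \<le> U a" "w' a < A a"
    and t: "t \<in> {a..<c}"
  shows "w t \<le> U t" "w' t < A t"
proof -
  have contU: "continuous_on {0..<T} U" by (rule ode_super_continuous[OF sup])
  have contA: "continuous_on {0..<T} A" using sup by (simp add: ode_super_def)
  have contw: "continuous_on {a..<c} w"
    by (meson DERIV_isCont continuous_at_imp_continuous_on w)
  have contw': "continuous_on {a..<c} w'"
    by (meson DERIV_isCont continuous_at_imp_continuous_on w')
  have gap_mono: "U a - w a < U t - w t"
    if t: "a < t" "t < c" and gap: "\<And>s. s \<in> {a..<t} \<Longrightarrow> w' s < A s" for t
  proof (rule DERIV_pos_imp_increasing_open[OF t(1)])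
    fix x assume x: "a < x" "x < t"
    have "(U has_real_derivative A x) (at x within {0..<T})"
      using sup x t a by (auto simp: ode_super_def)
    moreover have "at x within {0..<T} = at x"
      using x t a by (intro at_within_interior) auto
    ultimately have "(U has_real_derivative A x) (at x)" by simp
    then have "((\<lambda>r. U r - w r) has_real_derivative A x - w' x) (at x)"
      using w[of x] x t by (auto intro: DERIV_diff)
    then show "\<exists>y. ((\<lambda>r. U r - w r) has_real_derivative y) (at x) \<and> 0 < y"
      using gap[of x] x by auto
  next
    show "continuous_on {a..t} (\<lambda>r. U r - w r)"
      by (intro continuous_on_diff continuous_on_subset[OF contU] continuous_on_subset[OF contw])
         (use t a in auto)
  qed
  have no_crossing: "w' t < A t" if t: "t \<in> {a..<c}" for t
  proof (rule ccontr)
    assume "\<not> w' t < A t"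
    \<comment> \<open>Its least element, which exists by compactness, is the first crossing
      time.\<close>
    define S where "S = {s \<in> {a..t}. A s - w' s \<le> 0}"
    have contV: "continuous_on {a..t} (\<lambda>r. A r - w' r)"
      by (intro continuous_on_diff continuous_on_subset[OF contA] continuous_on_subset[OF contw'])
         (use t a in auto)
    have "closed S"
      using continuous_closed_preimage[OF contV closed_atLeastAtMost closed_atMost[of 0]]
      by (simp add: S_def vimage_def Int_def)
    moreover have "bounded S"
      by (rule bounded_subset[of "{a..t}"]) (auto simp: S_def)
    ultimately have "compact S" by (simp add: compact_eq_bounded_closed)
    have "S \<noteq> {}" using \<open>\<not> w' t < A t\<close> t by (auto simp: S_def)
    then obtain t' where t': "t' \<in> S" "\<And>s. s \<in> S \<Longrightarrow> t' \<le> s"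
      using compact_attains_inf[OF \<open>compact S\<close>] by blast
    then have "a \<le> t'" "t' \<le> t" "A t' - w' t' \<le> 0" by (auto simp: S_def)
    then have "a < t'" using init(2) by (cases "a = t'") auto
    then have t'c: "t' < c" "0 < t'" "t' < T" using t a \<open>t' \<le> t\<close> by auto
    have gap: "w' s < A s" if "s \<in> {a..<t'}" for s
      using that t'(2)[of s] \<open>t' \<le> t\<close> by (force simp: S_def)
    have "w t' < U t'" using gap_mono[OF \<open>a < t'\<close> t'c(1) gap] init(1) by simp
    \<comment> \<open>The surplus in the comparison: the integrand belonging to \<open>U\<close>
      minus \<open>h\<close> is \<open>F r (w r) - b r * w' r\<close>, which dominates
      \<open>w''\<close>. Hence \<open>h >= 0\<close> on an interval forces \<open>A\<close> to grow
      at least as much as \<open>w'\<close> there.\<close>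
    define h where "h r = F r (U r) - F r (w r) - b r * (A r - w' r)" for r
    have sub_cont: "continuous_on {a..t'} U" "continuous_on {a..t'} w"
      "continuous_on {a..t'} A" "continuous_on {a..t'} w'" "continuous_on {a..t'} b"
      by (rule continuous_on_subset[OF contU] continuous_on_subset[OF contw]
          continuous_on_subset[OF contA] continuous_on_subset[OF contw'] continuous_on_subset[OF contb];
          use t'c a in auto)+
    have contFc: "continuous_on {a..t'} (\<lambda>r. F r (v r))" if "continuous_on {a..t'} v" for v
    proof -
      have "continuous_on {a..t'} (\<lambda>r. (r, v r))" by (intro continuous_intros that)
      then show ?thesis
        using continuous_on_compose2[OF contF, of "{a..t'}" "\<lambda>r. (r, v r)"] a
        by (simp add: image_subset_iff)
    qed
    have conth: "continuous_on {a..t'} h"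
      unfolding h_def by (intro continuous_intros contFc sub_cont)
    have "0 < h t'"
    proof -
      have "b t' * (A t' - w' t') \<le> 0"
        using b[of t'] t'c \<open>A t' - w' t' \<le> 0\<close> by (simp add: mult_nonneg_nonpos)
      moreover have "F t' (w t') < F t' (U t')"
        using mono[OF _ _ \<open>w t' < U t'\<close>] w_nonneg[of t'] \<open>a < t'\<close> t'c by simp
      ultimately show ?thesis by (simp add: h_def)
    qed
    moreover have "(h \<longlongrightarrow> h t') (at t' within {a..t'})"
      using conth \<open>a < t'\<close> by (simp add: continuous_on_def)
    ultimately have "\<forall>\<^sub>F r in at t' within {a..t'}. 0 < h r"
      by (rule order_tendstoD(1)[rotated])
    then obtain d where d: "d > 0" "\<And>r. r \<in> {a..t'} \<Longrightarrow> r \<noteq> t' \<Longrightarrow> dist r t' < d \<Longrightarrow> 0 < h r"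
      by (auto simp: eventually_at)
    \<comment> \<open>The midpoint keeps s > a >= 0, as increments are controlled only from positive
      times; the other term keeps s within distance d of t', where \<open>h\<close> is
      positive.\<close>
    define s where "s = max ((a + t') / 2) (t' - d / 2)"
    have s: "a < s" "s < t'" "t' - s < d"
      using \<open>a < t'\<close> d(1) by (auto simp: s_def max_def field_simps)
    have h_pos: "0 \<le> h r" if "r \<in> {s..t'}" for r
      using d(2)[of r] that s \<open>0 < h t'\<close> by (cases "r = t'") (auto simp: dist_real_def)
    have "(w'' has_integral (w' t' - w' s)) {s..t'}"
      by (rule fundamental_theorem_of_calculus)
         (use s t'c w' in \<open>auto simp: has_real_derivative_iff_has_vector_derivative[symmetric]
            intro: has_field_derivative_at_within\<close>)
    moreover have "((\<lambda>r. F r (U r) - b r * A r) has_integral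
        integral {s..t'} (\<lambda>r. F r (U r) - b r * A r)) {s..t'}"
      by (intro integrable_integral integrable_continuous_real
          continuous_on_subset[where s = "{a..t'}" and t = "{s..t'}"] continuous_intros contFc sub_cont)
         (use s in auto)
    moreover have "w'' r \<le> F r (U r) - b r * A r" if "r \<in> {s..t'}" for r
      using h_pos[OF that] sub[of r] that s t'c by (auto simp: h_def algebra_simps)
    ultimately have "w' t' - w' s \<le> integral {s..t'} (\<lambda>r. F r (U r) - b r * A r)"
      by (rule has_integral_le)
    also have "\<dots> \<le> A t' - A s"
      using sup s t'c a by (auto simp: ode_super_def)
    finally show False
      using gap[of s] s \<open>A t' - w' t' \<le> 0\<close> by auto
  qed
  show "w' t < A t" by (rule no_crossing[OF t])
  show "w t \<le> U t"
  proof (cases "t = a")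
    case False
    then show ?thesis
      using gap_mono[of t] no_crossing t init(1) by force
  qed (use init(1) in simp)
qed

section \<open>Blow-up caused by the power source\<close>

definition power_source :: "(real \<Rightarrow> real) \<Rightarrow> (real \<Rightarrow> real) \<Rightarrow> real \<Rightarrow> real \<Rightarrow> real \<Rightarrow> real" where
  "power_source q k p t y = q t * y + k t * \<bar>y\<bar> powr p"

lemma continuous_on_power_source:
  assumes "continuous_on {0..} q" "continuous_on {0..} k" "p > 0"
  shows "continuous_on ({0..} \<times> UNIV) (\<lambda>(t, y). power_source q k p t y)"
  unfolding power_source_def case_prod_unfold
proof (intro continuous_on_add continuous_on_mult continuous_on_powr' ballI)
  show "continuous_on ({0..} \<times> UNIV) (\<lambda>x::real \<times> real. q (fst x))"
    "continuous_on ({0..} \<times> UNIV) (\<lambda>x::real \<times> real. k (fst x))"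
    by (rule continuous_on_compose2[OF assms(1)] continuous_on_compose2[OF assms(2)];
        auto intro!: continuous_intros)+
qed (use assms(3) in \<open>auto intro!: continuous_intros\<close>)

lemma power_source_strict_mono:
  assumes "q t > 0" "k t \<ge> 0" "p > 0" "0 \<le> x" "x < y"
  shows "power_source q k p t x < power_source q k p t y"
  unfolding power_source_def
  by (intro add_less_le_mono mult_strict_left_mono mult_left_mono powr_mono2) (use assms in auto)

text \<open>In the comparison function Y X^(-\<sigma>) the variable X falls linearly from 1 at 2z to
  0 at 3z. The exponent satisfies \<sigma> p = \<sigma> + 2, which balances the second derivative
  against the p-th power, and X <= 1 allows the damping term to be measured by the same power
  X^(-\<sigma>-2). Cancelling Y times this power leaves the last hypothesis on Y. Since 3z < T,
  \<open>U\<close> is bounded up to 3z while the comparison function below it is not.\<close>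

lemma blow_up:
  fixes U A b q k :: "real \<Rightarrow> real"
  assumes sup: "ode_super T b (power_source q k p) U A"
    and cont: "continuous_on {0..} q" "continuous_on {0..} k" "continuous_on {0..} b"
    and b: "\<And>t. 0 \<le> t \<Longrightarrow> 0 \<le> b t" "\<And>t. 0 \<le> t \<Longrightarrow> b t \<le> B"
    and q: "\<And>t. 0 \<le> t \<Longrightarrow> 0 < q t" and k: "\<And>t. 0 \<le> t \<Longrightarrow> 0 \<le> k t"
    and k0: "\<And>t. 0 \<le> t \<Longrightarrow> t \<le> 3 * z \<Longrightarrow> k0 \<le> k t"
    and p: "p > 1" and z: "z > 0" "3 * z < T" and \<sigma>: "\<sigma> = 2 / (p - 1)"
    and Y: "Y > 0" "Y \<le> U (2 * z)" "Y * \<sigma> / z < A (2 * z)"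
      "\<sigma> * (\<sigma> + 1) / z\<^sup>2 + B * \<sigma> / z \<le> k0 * Y powr (p - 1)"
  shows False
proof -
  have \<sigma>0: "\<sigma> > 0" using p \<sigma> by simp
  have \<sigma>p: "- \<sigma> * p = - \<sigma> - 2" using p \<sigma> by (simp add: field_simps)
  define X where "X t = (3 * z - t) / z" for t
  define w where "w t = Y * X t powr (- \<sigma>)" for t
  define w' where "w' t = Y * \<sigma> / z * X t powr (- \<sigma> - 1)" for t
  define w'' where "w'' t = Y * \<sigma> * (\<sigma> + 1) / z\<^sup>2 * X t powr (- \<sigma> - 2)" for t
  have X: "0 < X t" "X t \<le> 1" if "t \<in> {2 * z..<3 * z}" for t
    using that z by (auto simp: X_def field_simps)
  have X': "(X has_real_derivative - 1 / z) (at t)" for t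
    unfolding X_def using z by (auto intro!: derivative_eq_intros)
  have U_ge: "w t \<le> U t" if t: "t \<in> {2 * z..<3 * z}" for t
  proof (rule ode_super_comparison(1)[OF sup continuous_on_power_source[OF cont(1,2)] cont(3) b(1) _ _ _ _ _ _ _ _ _ t])
    fix t assume t: "t \<in> {2 * z..<3 * z}"
    show "(w has_real_derivative w' t) (at t)"
      unfolding w_def w'_def
      by (rule DERIV_cong[OF DERIV_cmult[OF DERIV_fun_powr[OF X' X(1)[OF t]]]]) simp
    show "(w' has_real_derivative w'' t) (at t)"
      unfolding w'_def w''_def
      by (rule DERIV_cong[OF DERIV_cmult[OF DERIV_fun_powr[OF X' X(1)[OF t]]]])
         (use z in \<open>simp add: power2_eq_square field_simps\<close>)
    show "0 \<le> w t" using Y(1) by (simp add: w_def)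
    have t0: "0 \<le> t" "t \<le> 3 * z" using t z by auto
    have pos: "0 < X t powr (- \<sigma> - 2)" using X(1)[OF t] by simp
    have "b t * w' t \<le> B * (Y * \<sigma> / z * X t powr (- \<sigma> - 2))"
      unfolding w'_def using b[OF t0(1)] Y(1) \<sigma>0 z X[OF t]
      by (intro mult_mono mult_left_mono powr_mono') auto
    then have "w'' t + b t * w' t \<le> (\<sigma> * (\<sigma> + 1) / z\<^sup>2 + B * \<sigma> / z) * (Y * X t powr (- \<sigma> - 2))"
      by (simp add: w''_def algebra_simps)
    also have "\<dots> \<le> (k t * Y powr (p - 1)) * (Y * X t powr (- \<sigma> - 2))"
    proof (rule mult_right_mono)
      have "k0 * Y powr (p - 1) \<le> k t * Y powr (p - 1)"
        by (intro mult_right_mono k0 t0) simp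
      then show "\<sigma> * (\<sigma> + 1) / z\<^sup>2 + B * \<sigma> / z \<le> k t * Y powr (p - 1)" using Y(4) by simp
    qed (use Y(1) pos in simp)
    also have "\<dots> = k t * w t powr p"
    proof -
      have "w t powr p = Y powr p * X t powr (- \<sigma> * p)"
        using Y(1) X(1)[OF t] by (simp add: w_def powr_mult powr_powr)
      also have "Y powr p = Y powr (p - 1) * Y"
        using Y(1) by (simp add: powr_diff)
      finally show ?thesis unfolding \<sigma>p by (simp only: mult_ac)
    qed
    also have "\<dots> \<le> power_source q k p t (w t)"
      using q[OF t0(1)] \<open>0 \<le> w t\<close> by (simp add: power_source_def)
    finally show "w'' t + b t * w' t \<le> power_source q k p t (w t)" .
  next
    show "w (2 * z) \<le> U (2 * z)" "w' (2 * z) < A (2 * z)"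
      using Y z by (auto simp: w_def w'_def X_def)
  next
    fix t x y :: real assume "0 \<le> t" "0 \<le> x" "x < y"
    then show "power_source q k p t x < power_source q k p t y"
      using p by (intro power_source_strict_mono q k) auto
  qed (use p z in auto)
  have "continuous_on {2 * z..3 * z} U"
    by (rule continuous_on_subset[OF ode_super_continuous[OF sup]]) (use z in auto)
  then have "bounded (U ` {2 * z..3 * z})"
    by (intro compact_imp_bounded compact_continuous_image) auto
  then obtain M where M: "M > 0" "\<And>t. t \<in> {2 * z..3 * z} \<Longrightarrow> \<bar>U t\<bar> \<le> M"
    by (auto simp: bounded_pos)
  have "filterlim (\<lambda>x. Y * x powr (- \<sigma>)) at_top (at_right 0)"
    using Y(1) \<sigma>0 by real_asymp
  then have "\<forall>\<^sub>F x in at_right 0. M + 1 \<le> Y * x powr (- \<sigma>)"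
    by (simp add: filterlim_at_top)
  moreover have "\<forall>\<^sub>F x in at_right 0. x \<in> {0<..<1::real}"
    by (rule eventually_at_right_real) simp
  ultimately have "\<forall>\<^sub>F x in at_right 0. M + 1 \<le> Y * x powr (- \<sigma>) \<and> x \<in> {0<..<1}"
    by (rule eventually_conj)
  then obtain x where x: "M + 1 \<le> Y * x powr (- \<sigma>)" "0 < x" "x < 1"
    using eventually_happens[of _ "at_right (0::real)"] by auto
  define t where "t = 3 * z - x * z"
  have "t \<in> {2 * z..<3 * z}" "X t = x" using x z by (auto simp: t_def X_def)
  then show False
    using U_ge[of t] M(2)[of t] x(1) by (auto simp: w_def)
qed

section \<open>Growth of the mass from small data\<close>

lemma power_source_ge_linear: "k t \<ge> 0 \<Longrightarrow> q t * y \<le> power_source q k p t y"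
  by (simp add: power_source_def)

text \<open>A later comparison started at \<open>t1\<close> needs the value and the slope to be
  bounded below by multiples of \<epsilon>, although only one of the two data may be nonzero. A
  positive initial slope is propagated by a saturating profile. If only the mass is positive, the
  linear source has to create the slope, and an explicit parabola shows that this has happened by
  time 1.\<close>

lemma initial_growth:
  fixes b q k :: "real \<Rightarrow> real"
  assumes cont: "continuous_on {0..} q" "continuous_on {0..} k" "continuous_on {0..} b"
    and b: "\<And>t. 0 \<le> t \<Longrightarrow> 0 \<le> b t" "\<And>t. 0 \<le> t \<Longrightarrow> b t \<le> B"
    and q: "\<And>t. 0 \<le> t \<Longrightarrow> 0 < q t" and k: "\<And>t. 0 \<le> t \<Longrightarrow> 0 \<le> k t"
    and p: "p > 0" and t1: "1 \<le> t1" and u: "0 \<le> u0" "0 \<le> u1" "0 < u0 \<or> 0 < u1"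
  shows "\<exists>c>0. \<forall>\<epsilon> T U A. 0 < \<epsilon> \<and> t1 < T \<and> ode_super T b (power_source q k p) U A
     \<and> U 0 = \<epsilon> * u0 \<and> A 0 = \<epsilon> * u1 \<longrightarrow> c * \<epsilon> \<le> U t1 \<and> c * \<epsilon> \<le> A t1"
proof -
  have B: "0 \<le> B" using b[of 0] by simp
  have mono: "power_source q k p t x < power_source q k p t y" if "0 \<le> t" "0 \<le> x" "x < y" for t x y
    by (intro power_source_strict_mono q k p that)
  show ?thesis
  proof (cases "0 < u1")
    case True
    \<comment> \<open>K exceeds the bound on the damping, so the profile \<delta> (1 - exp (-K t))
      satisfies \<open>w'' + b w' <= 0\<close>; the factor 2 makes its initial slope half of u1,
      hence strictly smaller.\<close>
    define K \<delta> where "K = B + 1" and "\<delta> = u1 / (2 * K)"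
    have K: "K > 0" "\<delta> > 0" "\<delta> * K < u1" using B True by (auto simp: K_def \<delta>_def field_simps add_pos_nonneg)
    define c where "c = min (\<delta> * (1 - exp (- K * t1))) (\<delta> * K * exp (- K * t1))"
    have "c > 0" using K t1 by (auto simp: c_def)
    moreover have "c * \<epsilon> \<le> U t1 \<and> c * \<epsilon> \<le> A t1"
      if *: "0 < \<epsilon>" "t1 < T" "ode_super T b (power_source q k p) U A" "U 0 = \<epsilon> * u0" "A 0 = \<epsilon> * u1"
      for \<epsilon> T U A
    proof -
      define w w' w'' where "w t = \<epsilon> * (\<delta> * (1 - exp (- K * t)))"
        and "w' t = \<epsilon> * (\<delta> * K * exp (- K * t))" and "w'' t = - \<epsilon> * (\<delta> * K\<^sup>2 * exp (- K * t))" for t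
      have w_nonneg: "0 \<le> w t" if "t \<in> {0..<T}" for t
        using that *(1) K by (simp add: w_def)
      have sub: "w'' t + b t * w' t \<le> power_source q k p t (w t)" if t: "t \<in> {0..<T}" for t
      proof -
        have "w'' t + b t * w' t = \<epsilon> * \<delta> * K * exp (- K * t) * (b t - K)"
          by (simp add: w''_def w'_def algebra_simps power2_eq_square)
        also have "\<dots> \<le> 0"
          using b(2)[of t] t *(1) K by (intro mult_nonneg_nonpos) (auto simp: K_def)
        also have "0 \<le> q t * w t" using q[of t] t w_nonneg[OF t] by simp
        also have "\<dots> \<le> power_source q k p t (w t)" using k t by (simp add: power_source_ge_linear)
        finally show ?thesis .
      qed
      have init: "w 0 \<le> U 0" "w' 0 < A 0"
        using * K u by (auto simp: w_def w'_def)
      have D: "(w has_real_derivative w' t) (at t)" "(w' has_real_derivative w'' t) (at t)" for t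
        unfolding w_def w'_def w''_def
        by (auto intro!: derivative_eq_intros simp: power2_eq_square algebra_simps)
      have range: "0 \<le> (0::real)" "T \<le> T" "t1 \<in> {0..<T}" using t1 *(2) by (auto)
      have "w t1 \<le> U t1" "w' t1 < A t1"
        by (rule ode_super_comparison[OF *(3) continuous_on_power_source[OF cont(1,2) p] cont(3) b(1)
            mono D w_nonneg sub range(1,2) init range(3)]; assumption)+
      moreover have "c * \<epsilon> \<le> w t1" "c * \<epsilon> \<le> w' t1"
        using *(1) by (auto simp: c_def w_def w'_def mult.commute[of _ \<epsilon>])
      ultimately show ?thesis by linarith
    qed
    ultimately show ?thesis by blast
  next
    case False
    then have u0: "u0 > 0" using u by auto
    obtain tm where tm: "tm \<in> {0..t1 + 1}" "\<And>t. t \<in> {0..t1 + 1} \<Longrightarrow> q tm \<le> q t"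
      using continuous_attains_inf[of "{0..t1 + 1}" q] continuous_on_subset[OF cont(1)] t1 by force
    define Q D where "Q = q tm" and "D = 2 + B * (2 * (t1 + 1))"
    have Q: "Q > 0" "\<And>t. t \<in> {0..t1 + 1} \<Longrightarrow> Q \<le> q t" using q tm by (auto simp: Q_def)
    have D: "D > 0" using B t1 by (simp add: D_def add_pos_nonneg)
    \<comment> \<open>On [0, t1 + 1] the parabola stays above M/2 and \<open>w'' + b w'\<close> is
      at most M \<kappa> D. The choice makes this at most M Q/2, hence at most
      \<open>q w\<close>.\<close>
    define \<kappa> where "\<kappa> = min 1 (Q / (2 * D))"
    have \<kappa>: "0 < \<kappa>" "\<kappa> \<le> 1" using Q D by (auto simp: \<kappa>_def)
    have \<kappa>D: "\<kappa> * D \<le> Q / 2"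
    proof -
      have "\<kappa> * D \<le> Q / (2 * D) * D" using D by (intro mult_right_mono) (auto simp: \<kappa>_def)
      then show ?thesis using D by simp
    qed
    have "u0 * \<kappa> > 0" using u0 \<kappa> by simp
    moreover have "u0 * \<kappa> * \<epsilon> \<le> U t1 \<and> u0 * \<kappa> * \<epsilon> \<le> A t1"
      if *: "0 < \<epsilon>" "t1 < T" "ode_super T b (power_source q k p) U A" "U 0 = \<epsilon> * u0" "A 0 = \<epsilon> * u1"
      for \<epsilon> T U A
    proof -
      \<comment> \<open>One unit beyond \<open>t1\<close> leaves \<open>t1\<close> inside the
        half-open comparison interval and keeps the lower bound Q for \<open>q\<close>.\<close>
      define T' where "T' = min T (t1 + 1)"
      define M where "M = \<epsilon> * u0"
      have M: "M > 0" using *(1) u0 by (simp add: M_def)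
      \<comment> \<open>The initial slope -M \<kappa> is negative because the comparison needs it
        strictly below \<open>A 0\<close>, which is 0 in this case. For t >= 1 the parabola is back
        above M and its slope is at least M \<kappa>.\<close>
      define w w' w'' where "w t = M * (1 + \<kappa> * (t * t - t))"
        and "w' t = M * (\<kappa> * (2 * t - 1))" and "w'' t = M * (\<kappa> * 2)" for t
      have w_ge: "M / 2 \<le> w t" for t
      proof -
        have "0 \<le> (t - 1/2) * (t - 1/2)" by simp
        then have "- (1/2) \<le> t * t - t" by (simp add: algebra_simps)
        then have "\<kappa> * (- (1/2)) \<le> \<kappa> * (t * t - t)" using \<kappa> by (intro mult_left_mono) auto
        then have "1/2 \<le> 1 + \<kappa> * (t * t - t)" using \<kappa> by linarith
        then show ?thesis using mult_left_mono[of "1/2" "1 + \<kappa> * (t * t - t)" M] M by (simp add: w_def)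
      qed
      have sub: "w'' t + b t * w' t \<le> power_source q k p t (w t)" if t: "t \<in> {0..<T'}" for t
      proof -
        have "b t * (2 * t - 1) \<le> B * (2 * (t1 + 1))"
        proof -
          have "b t * (2 * t - 1) \<le> b t * (2 * (t1 + 1))"
            using t b(1)[of t] by (intro mult_left_mono) (auto simp: T'_def)
          also have "\<dots> \<le> B * (2 * (t1 + 1))"
            using t b(2)[of t] t1 by (intro mult_right_mono) auto
          finally show ?thesis .
        qed
        then have "M * \<kappa> * (2 + b t * (2 * t - 1)) \<le> M * \<kappa> * D"
          using M \<kappa> by (intro mult_left_mono) (auto simp: D_def)
        then have "w'' t + b t * w' t \<le> M * (\<kappa> * D)"
          by (simp add: w''_def w'_def algebra_simps)
        also have "\<dots> \<le> M * (Q / 2)" using M \<kappa>D by (intro mult_left_mono) auto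
        also have "\<dots> = Q * (M / 2)" by simp
        also have "\<dots> \<le> q t * w t"
          using Q(2)[of t] Q(1) t M w_ge[of t] by (intro mult_mono) (auto simp: T'_def)
        also have "\<dots> \<le> power_source q k p t (w t)" using k t by (simp add: power_source_ge_linear)
        finally show ?thesis .
      qed
      have w_nonneg: "0 \<le> w t" for t using w_ge[of t] M by linarith
      have init: "w 0 \<le> U 0" "w' 0 < A 0"
      proof -
        have "0 < M * \<kappa>" "0 \<le> \<epsilon> * u1" using M \<kappa> *(1) u by auto
        then show "w 0 \<le> U 0" "w' 0 < A 0" using * by (auto simp: w_def w'_def M_def)
      qed
      have D: "(w has_real_derivative w' t) (at t)" "(w' has_real_derivative w'' t) (at t)" for t
        unfolding w_def w'_def w''_def
        by (auto intro!: derivative_eq_intros simp: power2_eq_square algebra_simps)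
      have range: "0 \<le> (0::real)" "T' \<le> T" "t1 \<in> {0..<T'}" using t1 *(2) by (auto simp: T'_def)
      have "w t1 \<le> U t1" "w' t1 < A t1"
        by (rule ode_super_comparison[OF *(3) continuous_on_power_source[OF cont(1,2) p] cont(3) b(1)
            mono D w_nonneg sub range(1,2) init range(3)]; assumption)+
      moreover have "M * \<kappa> \<le> w t1" "M * \<kappa> \<le> w' t1"
      proof -
        have "0 \<le> t1 * t1 - t1" using t1 by (simp add: algebra_simps mult_left_le_one_le)
        then have "\<kappa> \<le> 1 + \<kappa> * (t1 * t1 - t1)" using \<kappa> by (simp add: add_increasing2)
        then show "M * \<kappa> \<le> w t1" unfolding w_def using M by (intro mult_left_mono) auto
        have "\<kappa> * 1 \<le> \<kappa> * (2 * t1 - 1)" using \<kappa> t1 by (intro mult_left_mono) auto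
        then show "M * \<kappa> \<le> w' t1" unfolding w'_def using M by (intro mult_left_mono) auto
      qed
      moreover have "u0 * \<kappa> * \<epsilon> = M * \<kappa>" by (simp add: M_def)
      ultimately show ?thesis by linarith
    qed
    ultimately show ?thesis by blast
  qed
qed

text \<open>The linear subsolution inequality is invariant under positive scaling, and the power
  source is nonnegative. The comparison starts at \<open>t1\<close>, from where on W is a
  subsolution; the scale c \<epsilon> / D combines the bounds of \<open>initial_growth\<close> with
  a number D above both the value and the slope of W there.\<close>

lemma subsolution_growth:
  fixes b q k W W' W'' :: "real \<Rightarrow> real"
  assumes cont: "continuous_on {0..} q" "continuous_on {0..} k" "continuous_on {0..} b"
    and b: "\<And>t. 0 \<le> t \<Longrightarrow> 0 \<le> b t" "\<And>t. 0 \<le> t \<Longrightarrow> b t \<le> B"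
    and q: "\<And>t. 0 \<le> t \<Longrightarrow> 0 < q t" and k: "\<And>t. 0 \<le> t \<Longrightarrow> 0 \<le> k t"
    and p: "p > 0" and t1: "1 \<le> t1" and u: "0 \<le> u0" "0 \<le> u1" "0 < u0 \<or> 0 < u1"
    and W: "\<And>t. t1 \<le> t \<Longrightarrow> (W has_real_derivative W' t) (at t)"
    and W': "\<And>t. t1 \<le> t \<Longrightarrow> (W' has_real_derivative W'' t) (at t)"
    and W_nonneg: "\<And>t. t1 \<le> t \<Longrightarrow> 0 \<le> W t"
    and sub: "\<And>t. t1 \<le> t \<Longrightarrow> W'' t + b t * W' t \<le> q t * W t"
  shows "\<exists>\<delta>>0. \<forall>\<epsilon> T U A t. 0 < \<epsilon> \<and> t1 < T \<and> ode_super T b (power_source q k p) U A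
     \<and> U 0 = \<epsilon> * u0 \<and> A 0 = \<epsilon> * u1 \<and> t \<in> {t1..<T} \<longrightarrow> \<delta> * \<epsilon> * W t \<le> U t \<and> \<delta> * \<epsilon> * W' t < A t"
proof -
  have mono: "power_source q k p t x < power_source q k p t y" if "0 \<le> t" "0 \<le> x" "x < y" for t x y
    by (intro power_source_strict_mono q k p that)
  obtain c where c: "c > 0" and
    start: "\<And>\<epsilon> T U A. 0 < \<epsilon> \<and> t1 < T \<and> ode_super T b (power_source q k p) U A
     \<and> U 0 = \<epsilon> * u0 \<and> A 0 = \<epsilon> * u1 \<Longrightarrow> c * \<epsilon> \<le> U t1 \<and> c * \<epsilon> \<le> A t1"
    using initial_growth[OF cont b q k p t1 u] by blast
  define D where "D = W t1 + \<bar>W' t1\<bar> + 1"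
  have D: "D > 0" "W t1 \<le> D" "W' t1 < D" using W_nonneg[of t1] by (auto simp: D_def)
  show ?thesis
  proof (intro exI[of _ "c / D"] conjI allI impI)
    show "c / D > 0" using c D by simp
    fix \<epsilon> T t :: real and U A
    assume *: "0 < \<epsilon> \<and> t1 < T \<and> ode_super T b (power_source q k p) U A
     \<and> U 0 = \<epsilon> * u0 \<and> A 0 = \<epsilon> * u1 \<and> t \<in> {t1..<T}"
    define e where "e = c / D * \<epsilon>"
    have e: "e > 0" "e * D = c * \<epsilon>" using c D * by (auto simp: e_def)
    have init: "e * W t1 \<le> U t1" "e * W' t1 < A t1"
      using start[of \<epsilon> T U A] * mult_left_mono[OF D(2), of e] mult_strict_left_mono[OF D(3), of e] e by auto
    have sub_e: "e * W'' t + b t * (e * W' t) \<le> power_source q k p t (e * W t)" if "t \<in> {t1..<T}" for t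
    proof -
      have "e * W'' t + b t * (e * W' t) = e * (W'' t + b t * W' t)" by (simp add: algebra_simps)
      also have "\<dots> \<le> e * (q t * W t)" using sub[of t] e that by (intro mult_left_mono) auto
      also have "\<dots> \<le> power_source q k p t (e * W t)"
        using power_source_ge_linear[of k t q "e * W t" p] k[of t] that t1 by (simp add: mult_ac)
      finally show ?thesis .
    qed
    have W_e: "((\<lambda>t. e * W t) has_real_derivative e * W' t) (at t)"
      "((\<lambda>t. e * W' t) has_real_derivative e * W'' t) (at t)" "0 \<le> e * W t" if "t \<in> {t1..<T}" for t
      using that W[of t] W'[of t] W_nonneg[of t] e by (auto intro!: DERIV_cmult)
    have range: "0 \<le> t1" "T \<le> T" "t \<in> {t1..<T}" and sup: "ode_super T b (power_source q k p) U A"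
      using * t1 by auto
    note ode_super_comparison[OF sup continuous_on_power_source[OF cont(1,2) p] cont(3) b(1) mono
        W_e(1,2,3) sub_e range(1,2) init range(3)]
    then show "c / D * \<epsilon> * W t \<le> U t" "c / D * \<epsilon> * W' t < A t" by (simp_all add: e_def)
  qed
qed

text \<open>The last three hypotheses of \<open>blow_up\<close> for Y = exp (d/2 z^\<gamma>), with
  lower bounds for the mass and its slope inserted and \<epsilon> eliminated. Of the available
  growth exp (d z^\<gamma>), half of the exponent is given to Y; the other half absorbs powers of z
  and constants. In the third condition the positive power p - 1 of Y beats the algebraic
  decay.\<close>

lemma eventually_blow_up_conditions:
  fixes d \<gamma> E N R \<delta> \<theta> \<sigma> B \<kappa> p :: real
  assumes "d > 0" "\<gamma> > 0" "\<delta> > 0" "\<theta> > 0" "\<sigma> > 0" "\<kappa> > 0" "p > 1" "R \<ge> 1"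
  shows "\<forall>\<^sub>F z in at_top. exp (d / 2 * z powr \<gamma>) \<le> \<delta> * (z powr (- E) * exp (d * z powr \<gamma>))"
    and "\<forall>\<^sub>F z in at_top. exp (d / 2 * z powr \<gamma>) * \<sigma> / z
       < \<delta> * \<theta> * (1 + 2 * z) powr (\<gamma> - 1) * (z powr (- E) * exp (d * z powr \<gamma>))"
    and "\<forall>\<^sub>F z in at_top. \<sigma> * (\<sigma> + 1) / z\<^sup>2 + B * \<sigma> / z
       \<le> \<kappa> * (3 * z + R) powr (- N) * exp (d / 2 * z powr \<gamma>) powr (p - 1)"
proof -
  show "\<forall>\<^sub>F z in at_top. exp (d / 2 * z powr \<gamma>) \<le> \<delta> * (z powr (- E) * exp (d * z powr \<gamma>))"
    using assms by real_asymp
  show "\<forall>\<^sub>F z in at_top. exp (d / 2 * z powr \<gamma>) * \<sigma> / z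
       < \<delta> * \<theta> * (1 + 2 * z) powr (\<gamma> - 1) * (z powr (- E) * exp (d * z powr \<gamma>))"
    using assms by real_asymp
  have "\<forall>\<^sub>F z in at_top. \<sigma> * (\<sigma> + 1) / z\<^sup>2 + B * \<sigma> / z
       \<le> \<kappa> * (3 * z + R) powr (- N) * exp ((p - 1) * (d / 2 * z powr \<gamma>))"
    using assms by real_asymp
  then show "\<forall>\<^sub>F z in at_top. \<sigma> * (\<sigma> + 1) / z\<^sup>2 + B * \<sigma> / z
       \<le> \<kappa> * (3 * z + R) powr (- N) * exp (d / 2 * z powr \<gamma>) powr (p - 1)"
    by (simp add: powr_def mult_ac)
qed

text \<open>The subsolution inequality for exp (\<nu> c (1 + t)^\<gamma>), with \<theta> = \<nu> c
  \<gamma>, after division by this function and by (1 + t)^(2\<gamma> - 2). Both terms on the left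
  tend to 0, the second because 1 - \<gamma> - \<beta> < 0, while the right side is
  positive.\<close>

lemma eventually_subsolution:
  fixes \<gamma> \<beta> \<theta> \<mu>1 \<mu>2 :: real
  assumes "\<gamma> > 0" "\<beta> > 1" "\<theta> > 0" "\<mu>1 \<ge> 0" "\<theta>\<^sup>2 < \<mu>2"
  shows "\<forall>\<^sub>F t in at_top. \<theta> * (\<gamma> - 1) * (1 + t) powr (- \<gamma>) + \<mu>1 * \<theta> * (1 + t) powr (1 - \<gamma> - \<beta>) \<le> \<mu>2 - \<theta>\<^sup>2"
proof -
  have "((\<lambda>t. \<theta> * (\<gamma> - 1) * (1 + t) powr (- \<gamma>)) \<longlongrightarrow> 0) at_top"
    using assms by real_asymp
  moreover have "((\<lambda>t. \<mu>1 * \<theta> * (1 + t) powr (1 - \<gamma> - \<beta>)) \<longlongrightarrow> 0) at_top"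
    using assms by real_asymp
  ultimately have "((\<lambda>t. \<theta> * (\<gamma> - 1) * (1 + t) powr (- \<gamma>) + \<mu>1 * \<theta> * (1 + t) powr (1 - \<gamma> - \<beta>)) \<longlongrightarrow> 0 + 0) at_top"
    by (rule tendsto_add)
  then have "\<forall>\<^sub>F t in at_top. \<theta> * (\<gamma> - 1) * (1 + t) powr (- \<gamma>) + \<mu>1 * \<theta> * (1 + t) powr (1 - \<gamma> - \<beta>) < \<mu>2 - \<theta>\<^sup>2"
    using assms by (intro order_tendstoD) auto
  then show ?thesis by (rule eventually_mono) simp
qed

text \<open>The relation between \<epsilon> and z turns \<epsilon> exp (c z^\<gamma>) into z^(-E).
  This removes \<epsilon> from everything required at time 2z, so the threshold Z can be chosen
  independently of \<epsilon>.\<close>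

lemma ode_lifespan:
  fixes \<mu>1 \<mu>2 \<alpha> \<beta> p \<kappa> N R u0 u1 E :: real
  assumes \<mu>: "\<mu>1 \<ge> 0" "\<mu>2 > 0" and \<alpha>: "\<alpha> < 1" and \<beta>: "\<beta> > 1" and p: "p > 1"
    and \<kappa>: "\<kappa> > 0" and N: "N \<ge> 0" and R: "R \<ge> 1" and u: "0 \<le> u0" "0 \<le> u1" "0 < u0 \<or> 0 < u1"
  defines "\<gamma> \<equiv> (1 - \<alpha>) / 2" and "c \<equiv> 2 / (1 - \<alpha>) * sqrt (\<mu>2 * exp (\<mu>1 / (1 - \<beta>)))"
    and "q \<equiv> \<lambda>t. \<mu>2 / (1 + t) powr (\<alpha> + 1)" and "b \<equiv> \<lambda>t. \<mu>1 / (1 + t) powr \<beta>"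
    and "k \<equiv> \<lambda>t. \<kappa> * (t + R) powr (- N)"
  shows "\<exists>Z>0. \<forall>\<epsilon> z T U A. 0 < \<epsilon> \<and> Z \<le> z \<and> \<epsilon> * z powr E * exp (c * z powr \<gamma>) = 1
     \<and> ode_super T b (power_source q k p) U A \<and> U 0 = \<epsilon> * u0 \<and> A 0 = \<epsilon> * u1 \<longrightarrow> T \<le> 3 * z"
proof -
  have cont: "continuous_on {0..} q" "continuous_on {0..} k" "continuous_on {0..} b"
    unfolding q_def k_def b_def using R by (auto intro!: continuous_intros)
  have b: "0 \<le> b t" "b t \<le> \<mu>1" if "0 \<le> t" for t
  proof -
    have "1 \<le> (1 + t) powr \<beta>" using that \<beta> by (intro ge_one_powr_ge_zero) auto
    then show "0 \<le> b t" "b t \<le> \<mu>1"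
      using \<mu> divide_left_mono[of 1 "(1 + t) powr \<beta>" \<mu>1] that by (simp_all add: b_def)
  qed
  have q: "0 < q t" and k: "0 \<le> k t" if "0 \<le> t" for t
    using that \<mu> \<kappa> by (auto simp: q_def k_def)
  have \<gamma>: "\<gamma> > 0" and \<alpha>_eq: "\<alpha> + 1 = 2 - 2 * \<gamma>" using \<alpha> by (auto simp: \<gamma>_def field_simps)
  define m where "m = exp (\<mu>1 / (1 - \<beta>))"
  have m: "0 < m" "m \<le> 1" using \<mu> \<beta> by (auto simp: m_def divide_nonneg_neg)
  have c: "c > 0" "c * \<gamma> = sqrt (\<mu>2 * m)" using \<alpha> \<mu> m by (auto simp: c_def \<gamma>_def m_def)
  \<comment> \<open>The midpoint of 2^(-\<gamma>) and 1: being below 1 gives \<theta>^2 < \<mu>2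
    even for \<mu>1 = 0, and being above 2^(-\<gamma>) makes the gain \<open>d\<close>
    positive.\<close>
  define \<nu> where "\<nu> = (1 + 2 powr (- \<gamma>)) / 2"
  have "2 powr (- \<gamma>) < (1::real)" using \<gamma> by (simp add: powr_less_one)
  then have \<nu>: "0 < \<nu>" "\<nu> < 1" by (auto simp: \<nu>_def add_pos_pos)
  have "1 < (2::real) powr \<gamma>" using \<gamma> by simp
  moreover have "\<nu> * 2 powr \<gamma> = (2 powr \<gamma> + 2 powr (- \<gamma>) * 2 powr \<gamma>) / 2"
    by (simp add: \<nu>_def algebra_simps)
  moreover have "2 powr (- \<gamma>) * 2 powr \<gamma> = (1::real)" by (simp add: powr_add[symmetric])
  ultimately have \<nu>2: "1 < \<nu> * 2 powr \<gamma>" by simp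
  define \<theta> where "\<theta> = \<nu> * c * \<gamma>"
  have \<theta>: "0 < \<theta>" "\<theta>\<^sup>2 < \<mu>2"
  proof -
    show "0 < \<theta>" using \<nu> c \<gamma> by (simp add: \<theta>_def)
    have "\<theta> = \<nu> * sqrt (\<mu>2 * m)" using c(2) by (simp add: \<theta>_def mult.assoc)
    then have "\<theta>\<^sup>2 = \<nu>\<^sup>2 * (\<mu>2 * m)" using \<mu> m by (simp add: power_mult_distrib)
    also have "\<dots> \<le> \<nu>\<^sup>2 * \<mu>2" using \<mu> m by (intro mult_left_mono) auto
    also have "\<dots> < 1 * \<mu>2" using \<nu> \<mu> by (intro mult_strict_right_mono) (auto simp: power_less_one_iff)
    finally show "\<theta>\<^sup>2 < \<mu>2" by simp
  qed
  obtain t0 where t0: "\<And>t. t0 \<le> t \<Longrightarrow>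
      \<theta> * (\<gamma> - 1) * (1 + t) powr (- \<gamma>) + \<mu>1 * \<theta> * (1 + t) powr (1 - \<gamma> - \<beta>) \<le> \<mu>2 - \<theta>\<^sup>2"
    using eventually_subsolution[OF \<gamma> \<beta> \<theta>(1) \<mu>(1) \<theta>(2)] by (auto simp: eventually_at_top_linorder)
  define t1 where "t1 = max 1 t0"
  have t1: "1 \<le> t1" "t0 \<le> t1" by (auto simp: t1_def)
  define W where "W t = exp (\<nu> * c * (1 + t) powr \<gamma>)" for t
  define W' where "W' t = \<theta> * (1 + t) powr (\<gamma> - 1) * W t" for t
  define W'' where "W'' t = \<theta> * (\<gamma> - 1) * (1 + t) powr (\<gamma> - 2) * W t + \<theta>\<^sup>2 * (1 + t) powr (2 * \<gamma> - 2) * W t" for t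
  have W: "(W has_real_derivative W' t) (at t)" if "t1 \<le> t" for t
  proof -
    have pos: "0 < 1 + t" using that t1 by linarith
    have "((\<lambda>t. (1 + t) powr \<gamma>) has_real_derivative \<gamma> * (1 + t) powr (\<gamma> - 1)) (at t)"
      using DERIV_fun_powr[of "\<lambda>t. 1 + t" 1 t \<gamma>] pos by (auto intro!: derivative_eq_intros)
    from DERIV_fun_exp[OF DERIV_cmult[OF this, of "\<nu> * c"]] show ?thesis
      by (simp add: W_def[abs_def] W'_def \<theta>_def mult_ac)
  qed
  have W': "(W' has_real_derivative W'' t) (at t)" if "t1 \<le> t" for t
  proof -
    have pos: "0 < 1 + t" using that t1 by linarith
    have "((\<lambda>t. (1 + t) powr (\<gamma> - 1)) has_real_derivative (\<gamma> - 1) * (1 + t) powr (\<gamma> - 2)) (at t)"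
      using DERIV_fun_powr[of "\<lambda>t. 1 + t" 1 t "\<gamma> - 1"] pos by (auto intro!: derivative_eq_intros)
    from DERIV_mult[OF DERIV_cmult[OF this, of \<theta>] W[OF that]]
    have "(W' has_real_derivative \<theta> * ((\<gamma> - 1) * (1 + t) powr (\<gamma> - 2)) * W t
       + W' t * (\<theta> * (1 + t) powr (\<gamma> - 1))) (at t)"
      by (simp add: W'_def[abs_def])
    moreover have "W' t * (\<theta> * (1 + t) powr (\<gamma> - 1)) = \<theta>\<^sup>2 * ((1 + t) powr (\<gamma> - 1) * (1 + t) powr (\<gamma> - 1)) * W t"
      by (simp add: W'_def power2_eq_square)
    moreover have "(1 + t) powr (\<gamma> - 1) * (1 + t) powr (\<gamma> - 1) = (1 + t) powr (2 * \<gamma> - 2)"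
      by (simp add: powr_add[symmetric])
    ultimately show ?thesis by (simp add: W''_def mult_ac)
  qed
  have W_pos: "0 < W t" for t by (simp add: W_def)
  have sub: "W'' t + b t * W' t \<le> q t * W t" if "t1 \<le> t" for t
  proof -
    have pos: "0 < 1 + t" using that t1 by linarith
    \<comment> \<open>Pulling out the common factor P reduces the claim to the inequality that holds
      from \<open>t0\<close> on.\<close>
    define s P where "s = 1 + t" and "P = s powr (2 * \<gamma> - 2) * W t"
    have s: "s > 0" using pos by (simp add: s_def)
    have "W'' t = (\<theta> * (\<gamma> - 1) * s powr (- \<gamma>) + \<theta>\<^sup>2) * P"
    proof -
      have "s powr (\<gamma> - 2) = s powr (- \<gamma>) * s powr (2 * \<gamma> - 2)" by (simp add: powr_add[symmetric])
      then show ?thesis by (simp add: W''_def P_def s_def algebra_simps)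
    qed
    moreover have "b t * W' t = \<mu>1 * \<theta> * s powr (1 - \<gamma> - \<beta>) * P"
    proof -
      have "s powr (\<gamma> - 1) / s powr \<beta> = s powr (1 - \<gamma> - \<beta>) * s powr (2 * \<gamma> - 2)"
        by (simp add: powr_add[symmetric] powr_diff[symmetric] algebra_simps)
      moreover have "b t * W' t = \<mu>1 * \<theta> * (s powr (\<gamma> - 1) / s powr \<beta>) * W t"
        by (simp add: b_def W'_def s_def)
      ultimately show ?thesis by (simp add: P_def)
    qed
    ultimately have "W'' t + b t * W' t
       = (\<theta> * (\<gamma> - 1) * s powr (- \<gamma>) + \<mu>1 * \<theta> * s powr (1 - \<gamma> - \<beta>) + \<theta>\<^sup>2) * P"
      by (simp add: algebra_simps)
    also have "\<dots> \<le> \<mu>2 * P"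
      using t0[of t] that t1 W_pos[of t] by (intro mult_right_mono) (auto simp: P_def s_def)
    also have "\<dots> = q t * W t"
    proof -
      have "\<mu>2 / s powr (2 - 2 * \<gamma>) = \<mu>2 * s powr (2 * \<gamma> - 2)"
        by (simp add: powr_minus_divide[symmetric] divide_inverse powr_minus[symmetric])
      then show ?thesis by (simp add: q_def P_def s_def \<alpha>_eq)
    qed
    finally show ?thesis .
  qed
  have p0: "p > 0" using p by simp
  obtain \<delta> where \<delta>: "\<delta> > 0" and growth: "\<And>\<epsilon> T U A t. 0 < \<epsilon> \<Longrightarrow> t1 < T \<Longrightarrow>
      ode_super T b (power_source q k p) U A \<Longrightarrow> U 0 = \<epsilon> * u0 \<Longrightarrow> A 0 = \<epsilon> * u1 \<Longrightarrow> t \<in> {t1..<T} \<Longrightarrow>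
      \<delta> * \<epsilon> * W t \<le> U t \<and> \<delta> * \<epsilon> * W' t < A t"
    using subsolution_growth[OF cont b q k p0 t1(1) u W W' less_imp_le[OF W_pos] sub] by blast
  \<comment> \<open>The excess of the exponent \<nu> c (2z)^\<gamma>, available at time 2z, over c
    z^\<gamma>, in units of z^\<gamma>.\<close>
  define d where "d = c * (\<nu> * 2 powr \<gamma> - 1)"
  have d: "d > 0" using c \<nu>2 by (simp add: d_def)
  define \<sigma> where "\<sigma> = 2 / (p - 1)"
  have \<sigma>: "\<sigma> > 0" using p by (simp add: \<sigma>_def)
  have "\<forall>\<^sub>F z in at_top. exp (d / 2 * z powr \<gamma>) \<le> \<delta> * (z powr (- E) * exp (d * z powr \<gamma>)) \<and>
      exp (d / 2 * z powr \<gamma>) * \<sigma> / z < \<delta> * \<theta> * (1 + 2 * z) powr (\<gamma> - 1) * (z powr (- E) * exp (d * z powr \<gamma>)) \<and>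
      \<sigma> * (\<sigma> + 1) / z\<^sup>2 + \<mu>1 * \<sigma> / z \<le> \<kappa> * (3 * z + R) powr (- N) * exp (d / 2 * z powr \<gamma>) powr (p - 1)"
    by (intro eventually_conj eventually_blow_up_conditions[OF d \<gamma> \<delta> \<theta>(1) \<sigma> \<kappa> p R])
  then obtain Z0 where Z0: "\<And>z. Z0 \<le> z \<Longrightarrow>
      exp (d / 2 * z powr \<gamma>) \<le> \<delta> * (z powr (- E) * exp (d * z powr \<gamma>)) \<and>
      exp (d / 2 * z powr \<gamma>) * \<sigma> / z < \<delta> * \<theta> * (1 + 2 * z) powr (\<gamma> - 1) * (z powr (- E) * exp (d * z powr \<gamma>)) \<and>
      \<sigma> * (\<sigma> + 1) / z\<^sup>2 + \<mu>1 * \<sigma> / z \<le> \<kappa> * (3 * z + R) powr (- N) * exp (d / 2 * z powr \<gamma>) powr (p - 1)"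
    by (auto simp: eventually_at_top_linorder)
  show ?thesis
  proof (intro exI[of _ "max t1 Z0"] conjI allI impI)
    show "0 < max t1 Z0" using t1 by auto
    fix \<epsilon> z T :: real and U A
    assume *: "0 < \<epsilon> \<and> max t1 Z0 \<le> z \<and> \<epsilon> * z powr E * exp (c * z powr \<gamma>) = 1
     \<and> ode_super T b (power_source q k p) U A \<and> U 0 = \<epsilon> * u0 \<and> A 0 = \<epsilon> * u1"
    then have z: "z > 0" "t1 \<le> z" "Z0 \<le> z" using t1 by auto
    show "T \<le> 3 * z"
    proof (rule ccontr)
      assume "\<not> T \<le> 3 * z"
      then have T: "3 * z < T" by simp
      define Y where "Y = exp (d / 2 * z powr \<gamma>)"
      note zs = Z0[OF z(3), folded Y_def]
      have "\<epsilon> * exp (c * z powr \<gamma>) = z powr (- E)"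
        using * z(1) by (simp add: powr_minus field_simps)
      have "exp (\<nu> * c * (2 * z) powr \<gamma>) = exp (c * z powr \<gamma>) * exp (d * z powr \<gamma>)"
        using z(1) by (simp add: exp_add[symmetric] d_def powr_mult algebra_simps)
      moreover have "exp (\<nu> * c * (2 * z) powr \<gamma>) \<le> W (2 * z)"
        unfolding W_def using z(1) \<gamma> \<nu> c by (auto intro!: powr_mono2)
      ultimately have "exp (c * z powr \<gamma>) * exp (d * z powr \<gamma>) \<le> W (2 * z)" by simp
      then have "\<epsilon> * (exp (c * z powr \<gamma>) * exp (d * z powr \<gamma>)) \<le> \<epsilon> * W (2 * z)"
        using * by (intro mult_left_mono) auto
      moreover have "\<epsilon> * (exp (c * z powr \<gamma>) * exp (d * z powr \<gamma>)) = z powr (- E) * exp (d * z powr \<gamma>)"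
        using \<open>\<epsilon> * exp (c * z powr \<gamma>) = z powr (- E)\<close> by (metis mult.assoc)
      ultimately have "z powr (- E) * exp (d * z powr \<gamma>) \<le> \<epsilon> * W (2 * z)" by simp
      then have W_ge: "\<delta> * (z powr (- E) * exp (d * z powr \<gamma>)) \<le> \<delta> * \<epsilon> * W (2 * z)"
        using \<delta> by (simp add: mult.assoc)
      have g: "\<delta> * \<epsilon> * W (2 * z) \<le> U (2 * z) \<and> \<delta> * \<epsilon> * W' (2 * z) < A (2 * z)"
        using * z T by (intro growth[of \<epsilon> T U A]) auto
      show False
      proof (rule blow_up)
        show "ode_super T b (power_source q k p) U A" using * by blast
        show "continuous_on {0..} q" "continuous_on {0..} k" "continuous_on {0..} b" by (fact cont)+
        show "\<And>t. 0 \<le> t \<Longrightarrow> 0 \<le> b t" "\<And>t. 0 \<le> t \<Longrightarrow> b t \<le> \<mu>1" by (fact b)+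
        show "\<And>t. 0 \<le> t \<Longrightarrow> 0 < q t" "\<And>t. 0 \<le> t \<Longrightarrow> 0 \<le> k t" by (fact q, fact k)
        show "\<kappa> * (3 * z + R) powr (- N) \<le> k t" if "0 \<le> t" "t \<le> 3 * z" for t
          unfolding k_def using \<kappa> N R that by (intro mult_left_mono powr_mono2') auto
        show "1 < p" "0 < z" "3 * z < T" by (fact p, fact z, fact T)
        show "\<sigma> = 2 / (p - 1)" by (fact \<sigma>_def)
        show "0 < Y" by (simp add: Y_def)
        show "Y \<le> U (2 * z)" using zs W_ge g by linarith
        have "Y * \<sigma> / z < \<theta> * (1 + 2 * z) powr (\<gamma> - 1) * (\<delta> * (z powr (- E) * exp (d * z powr \<gamma>)))"
          using zs by (simp add: mult_ac)
        also have "\<dots> \<le> \<theta> * (1 + 2 * z) powr (\<gamma> - 1) * (\<delta> * \<epsilon> * W (2 * z))"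
          using W_ge \<theta> by (intro mult_left_mono) auto
        also have "\<dots> = \<delta> * \<epsilon> * W' (2 * z)" by (simp add: W'_def)
        also have "\<dots> < A (2 * z)" using g by blast
        finally show "Y * \<sigma> / z < A (2 * z)" .
        show "\<sigma> * (\<sigma> + 1) / z\<^sup>2 + \<mu>1 * \<sigma> / z \<le> \<kappa> * (3 * z + R) powr (- N) * Y powr (p - 1)"
          using zs by blast
      qed
    qed
  qed
qed

section \<open>The function zeta\<close>

text \<open>\<open>zeta\<close> is a \<open>GREATEST\<close>, which says something only once a
  largest root is known to exist. F tends to infinity whatever the sign of the exponent E, so the
  roots are bounded above and continuity supplies a largest one. F need not be monotone when E < 0,
  so several roots are possible.\<close>

lemma zeta_large:
  fixes Z :: real
  assumes "\<mu>2 > 0" "\<alpha> < 1" "Z > 0"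
  shows "\<exists>\<epsilon>0>0. \<forall>\<epsilon>. 0 < \<epsilon> \<and> \<epsilon> \<le> \<epsilon>0 \<longrightarrow> Z \<le> zeta n p \<mu>1 \<mu>2 \<alpha> \<beta> \<epsilon> \<and>
     \<epsilon> * zeta n p \<mu>1 \<mu>2 \<alpha> \<beta> \<epsilon> powr (2 / (p - 1) - real n + (1 + \<alpha>) / 4)
        * exp (2 / (1 - \<alpha>) * sqrt (\<mu>2 * exp (\<mu>1 / (1 - \<beta>))) * zeta n p \<mu>1 \<mu>2 \<alpha> \<beta> \<epsilon> powr ((1 - \<alpha>) / 2)) = 1"
proof -
  define E where "E = 2 / (p - 1) - real n + (1 + \<alpha>) / 4"
  define c where "c = 2 / (1 - \<alpha>) * sqrt (\<mu>2 * exp (\<mu>1 / (1 - \<beta>)))"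
  define \<gamma> where "\<gamma> = (1 - \<alpha>) / 2"
  define F where "F z = z powr E * exp (c * z powr \<gamma>)" for z
  have c: "c > 0" and \<gamma>: "\<gamma> > 0" using assms by (auto simp: c_def \<gamma>_def)
  have F_pos: "F z > 0" if "z > 0" for z using that by (simp add: F_def)
  have contF: "continuous_on {a..b} F" if "a > 0" for a b
    unfolding F_def using that by (auto intro!: continuous_intros)
  have F_top: "filterlim F at_top at_top"
    unfolding F_def using c \<gamma> by real_asymp
  have zeta_eq: "zeta n p \<mu>1 \<mu>2 \<alpha> \<beta> \<epsilon> = (GREATEST z. 0 < z \<and> \<epsilon> * F z = 1)" for \<epsilon>
    unfolding zeta_def F_def E_def c_def \<gamma>_def by (simp add: mult.assoc)
  \<comment> \<open>The bound on \<epsilon> is exactly \<epsilon> F(Z) <= 1, so the intermediate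
    value theorem finds a root to the right of Z.\<close>
  have main: "Z \<le> (GREATEST z. 0 < z \<and> \<epsilon> * F z = 1) \<and> \<epsilon> * F (GREATEST z. 0 < z \<and> \<epsilon> * F z = 1) = 1"
    if \<epsilon>: "0 < \<epsilon>" "\<epsilon> \<le> inverse (F Z)" for \<epsilon>
  proof -
    have "\<forall>\<^sub>F z in at_top. inverse \<epsilon> + 1 \<le> F z" using F_top by (simp add: filterlim_at_top)
    then obtain M where M: "\<And>z. M \<le> z \<Longrightarrow> inverse \<epsilon> + 1 \<le> F z"
      by (auto simp: eventually_at_top_linorder)
    have large: "\<epsilon> * F z > 1" if "M \<le> z" for z
    proof -
      have "\<epsilon> * (inverse \<epsilon> + 1) \<le> \<epsilon> * F z" using M[OF that] \<epsilon> by (intro mult_left_mono) auto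
      then show ?thesis using \<epsilon> by (simp add: algebra_simps)
    qed
    define M' where "M' = max M Z"
    have small: "\<epsilon> * F Z \<le> 1"
      using mult_right_mono[OF \<epsilon>(2), of "F Z"] F_pos[OF assms(3)] by simp
    have cont: "continuous_on {Z..M'} (\<lambda>z. \<epsilon> * F z)"
      by (intro continuous_intros contF assms)
    define S where "S = {z \<in> {Z..M'}. \<epsilon> * F z = 1}"
    have "closed S"
      using continuous_closed_preimage[OF cont closed_atLeastAtMost, of "{1}"]
      by (simp add: S_def vimage_def Int_def)
    moreover have "bounded S"
      by (rule bounded_subset[of "{Z..M'}"]) (auto simp: S_def)
    ultimately have "compact S" by (simp add: compact_eq_bounded_closed)
    have "S \<noteq> {}"
      using IVT'[OF small _ _ cont] large[of M'] by (force simp: S_def M'_def)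
    then obtain z where z: "z \<in> S" "\<And>y. y \<in> S \<Longrightarrow> y \<le> z"
      using compact_attains_sup[OF \<open>compact S\<close>] by blast
    have "(GREATEST z. 0 < z \<and> \<epsilon> * F z = 1) = z"
    proof (rule Greatest_equality)
      show "0 < z \<and> \<epsilon> * F z = 1" using z(1) assms by (auto simp: S_def)
      fix y assume y: "0 < y \<and> \<epsilon> * F y = 1"
      then have "y \<le> M'" using large[of y] by (force simp: M'_def)
      then show "y \<le> z"
        using z y by (cases "Z \<le> y") (auto simp: S_def)
    qed
    then show ?thesis using z(1) by (simp add: S_def)
  qed
  have "Z \<le> zeta n p \<mu>1 \<mu>2 \<alpha> \<beta> \<epsilon> \<and>
      \<epsilon> * zeta n p \<mu>1 \<mu>2 \<alpha> \<beta> \<epsilon> powr E * exp (c * zeta n p \<mu>1 \<mu>2 \<alpha> \<beta> \<epsilon> powr \<gamma>) = 1"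
    if "0 < \<epsilon>" "\<epsilon> \<le> inverse (F Z)" for \<epsilon>
    using main[OF that, folded zeta_eq] unfolding F_def by (simp only: mult.assoc)
  then show ?thesis
    using F_pos[OF assms(3)] unfolding E_def c_def \<gamma>_def by (intro exI[of _ "inverse (F Z)"]) auto
qed

section \<open>From the energy solution to the differential inequality\<close>

text \<open>Convexity: the graph lies above its tangent at c. For c > 0 this is Young's inequality
  for y and c^(p-1) with the conjugate exponents p and p/(p-1).\<close>

lemma powr_tangent_le:
  fixes y c p :: real
  assumes "p > 1" "y \<ge> 0" "c \<ge> 0"
  shows "c powr p + p * c powr (p - 1) * (y - c) \<le> y powr p"
proof (cases "c = 0")
  case False
  then have c: "c > 0" using assms by simp
  have "y * c powr (p - 1) \<le> y powr p / p + (c powr (p - 1)) powr (p / (p - 1)) / (p / (p - 1))"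
    using assms by (intro Youngs_inequality) (auto simp: field_simps)
  also have "(c powr (p - 1)) powr (p / (p - 1)) = c powr p"
    using assms by (simp add: powr_powr)
  finally have "p * (y * c powr (p - 1)) \<le> p * (y powr p / p + c powr p / (p / (p - 1)))"
    using assms by (intro mult_left_mono) auto
  also have "\<dots> = y powr p + (p - 1) * c powr p"
    using assms by (simp add: field_simps)
  finally have "p * (y * c powr (p - 1)) \<le> y powr p + (p - 1) * c powr p" .
  moreover have "c powr (p - 1) * c = c powr p" using c by (simp add: powr_diff)
  ultimately show ?thesis by (simp add: algebra_simps)
qed (use assms in simp)

text \<open>The tangent inequality at c = \<bar>\<integral>f\<bar> / V is integrated, with c
  multiplied by the indicator of B so that both sides vanish off B. What the linear term leaves is a
  nonnegative multiple of \<integral>\<bar>f\<bar> - \<bar>\<integral>f\<bar>.\<close>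

lemma Jensen_powr_supported:
  fixes f :: "'a \<Rightarrow> real"
  assumes p: "p > 1" and B: "B \<in> fmeasurable M" "measure M B > 0"
    and f: "integrable M f" "integrable M (\<lambda>x. \<bar>f x\<bar> powr p)"
    and supp: "AE x in M. x \<notin> B \<longrightarrow> f x = 0"
  shows "measure M B powr (1 - p) * \<bar>\<integral>x. f x \<partial>M\<bar> powr p \<le> (\<integral>x. \<bar>f x\<bar> powr p \<partial>M)"
proof -
  define V c where "V = measure M B" and "c = \<bar>\<integral>x. f x \<partial>M\<bar> / V"
  have V: "V > 0" using B by (simp add: V_def)
  have c: "c \<ge> 0" using V by (simp add: c_def)
  have int_B: "integrable M (indicator B :: 'a \<Rightarrow> real)" using B by (simp add: fmeasurable_def)
  have "V * c powr p + p * c powr (p - 1) * ((\<integral>x. \<bar>f x\<bar> \<partial>M) - V * c)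
      = (\<integral>x. c powr p * indicator B x + p * c powr (p - 1) * (\<bar>f x\<bar> - c * indicator B x) \<partial>M)"
    using f int_B fmeasurableD[OF B(1)] by (simp add: V_def)
  also have "\<dots> \<le> (\<integral>x. \<bar>f x\<bar> powr p \<partial>M)"
  proof (rule integral_mono_AE)
    show "AE x in M. c powr p * indicator B x + p * c powr (p - 1) * (\<bar>f x\<bar> - c * indicator B x) \<le> \<bar>f x\<bar> powr p"
      using supp by eventually_elim (use powr_tangent_le[OF p _ c] in \<open>auto simp: indicator_def\<close>)
  qed (use f int_B in auto)
  finally have "V * c powr p + p * c powr (p - 1) * ((\<integral>x. \<bar>f x\<bar> \<partial>M) - V * c) \<le> (\<integral>x. \<bar>f x\<bar> powr p \<partial>M)" .
  moreover have "0 \<le> p * c powr (p - 1) * ((\<integral>x. \<bar>f x\<bar> \<partial>M) - V * c)"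
    using p V integral_abs_bound[of M f] by (simp add: c_def)
  moreover have "V * c powr p = V powr (1 - p) * \<bar>\<integral>x. f x \<partial>M\<bar> powr p"
    using V by (simp add: c_def powr_divide powr_diff)
  ultimately show ?thesis by (simp add: V_def)
qed

section \<open>Square-integrable functions supported in a ball\<close>

lemma L2_measurable: "L2 f \<Longrightarrow> f \<in> borel_measurable lebesgue"
  by (simp add: L2_def)

lemma L2_integrable_square: "L2 f \<Longrightarrow> integrable lebesgue (\<lambda>x. (f x)\<^sup>2)"
  by (simp add: L2_def)

lemma L2_mult_integrable:
  assumes "L2 f" "L2 g"
  shows "integrable lebesgue (\<lambda>x. f x * g x)"
proof (rule Bochner_Integration.integrable_bound)
  show "integrable lebesgue (\<lambda>x. (f x)\<^sup>2 + (g x)\<^sup>2)"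
    using assms by (auto simp: L2_def)
  show "(\<lambda>x. f x * g x) \<in> borel_measurable lebesgue"
    using assms by (auto simp: L2_def)
  have "norm (a * b) \<le> norm (a\<^sup>2 + b\<^sup>2)" for a b :: real
  proof -
    have "0 \<le> \<bar>a\<bar> * \<bar>b\<bar>" "2 * (\<bar>a\<bar> * \<bar>b\<bar>) \<le> a\<^sup>2 + b\<^sup>2"
      using sum_squares_bound[of "\<bar>a\<bar>" "\<bar>b\<bar>"] by (simp_all add: mult.assoc)
    then have "\<bar>a\<bar> * \<bar>b\<bar> \<le> a\<^sup>2 + b\<^sup>2" by linarith
    then show ?thesis by (simp add: abs_mult)
  qed
  then show "AE x in lebesgue. norm (f x * g x) \<le> norm ((f x)\<^sup>2 + (g x)\<^sup>2)"
    by simp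
qed

lemma L2_add: assumes "L2 f" "L2 g" shows "L2 (\<lambda>x. f x + g x)"
proof -
  have "integrable lebesgue (\<lambda>x. (f x)\<^sup>2 + (g x)\<^sup>2 + 2 * (f x * g x))"
    using L2_mult_integrable[OF assms] assms by (auto simp: L2_def)
  then show ?thesis using assms by (auto simp: L2_def power2_sum mult.assoc)
qed

lemma L2_cmult: "L2 f \<Longrightarrow> L2 (\<lambda>x. c * f x)"
  by (auto simp: L2_def power_mult_distrib)

lemma L2_diff: "L2 f \<Longrightarrow> L2 g \<Longrightarrow> L2 (\<lambda>x. f x - g x)"
  using L2_add[of f "\<lambda>x. (-1) * g x"] L2_cmult[of g "-1"] by simp

lemma L2_continuous_compact_support:
  fixes f :: "'a::euclidean_space \<Rightarrow> real"
  assumes "continuous_on UNIV f" "\<And>x. x \<notin> cball 0 r \<Longrightarrow> f x = 0"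
  shows "L2 f"
  unfolding L2_def
proof
  have "f \<in> borel_measurable borel" using assms(1) by (rule borel_measurable_continuous_onI)
  then show "f \<in> borel_measurable lebesgue" by (simp add: measurable_completion)
  have "integrable lborel (\<lambda>x. indicator (cball 0 r) x *\<^sub>R (f x)\<^sup>2)"
    using continuous_on_subset[OF assms(1)]
    by (intro borel_integrable_compact continuous_intros) auto
  then have "integrable lebesgue (\<lambda>x. indicator (cball 0 r) x *\<^sub>R (f x)\<^sup>2)"
    by (subst integrable_completion) (auto dest: borel_measurable_integrable)
  moreover have "(\<lambda>x. indicator (cball 0 r) x *\<^sub>R (f x)\<^sup>2) = (\<lambda>x. (f x)\<^sup>2)"
    using assms(2) by (auto simp: fun_eq_iff indicator_def)
  ultimately show "integrable lebesgue (\<lambda>x. (f x)\<^sup>2)"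
    by (simp only:)
qed

lemma L2_indicator: "A \<in> lmeasurable \<Longrightarrow> L2 (indicator A)"
  unfolding L2_def
proof
  assume A: "A \<in> lmeasurable"
  then show "(indicator A :: 'a \<Rightarrow> real) \<in> borel_measurable lebesgue" by auto
  have "(\<lambda>x. (indicator A x :: real)\<^sup>2) = indicator A" by (auto simp: indicator_def)
  then show "integrable lebesgue (\<lambda>x. (indicator A x :: real)\<^sup>2)"
    using A by (auto intro: integrable_real_indicator simp: fmeasurable_def less_top)
qed

lemma L2_supported_integrable:
  assumes f: "L2 f" and supp: "AE x in lebesgue. x \<notin> cball 0 r \<longrightarrow> f x = 0"
  shows "integrable lebesgue f"
proof -
  have "integrable lebesgue (\<lambda>x. f x * indicator (cball 0 r) x)"
    by (intro L2_mult_integrable f L2_indicator) simp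
  moreover have "AE x in lebesgue. f x * indicator (cball 0 r) x = f x"
    using supp by eventually_elim (auto simp: indicator_def)
  ultimately show ?thesis
    using L2_measurable[OF f] by (subst integrable_cong_AE[symmetric]) auto
qed

text \<open>Cauchy-Schwarz against the indicator of the ball, obtained as the case of exponent 2 of
  Jensen's inequality.\<close>

lemma L2_supported_integral_square_le:
  fixes f :: "'a::euclidean_space \<Rightarrow> real"
  assumes f: "L2 f" and supp: "AE x in lebesgue. x \<notin> cball 0 r \<longrightarrow> f x = 0" and r: "r > 0"
  shows "(\<integral>x. f x \<partial>lebesgue)\<^sup>2 \<le> measure lebesgue (cball (0::'a) r) * (\<integral>x. (f x)\<^sup>2 \<partial>lebesgue)"
proof -
  have V: "measure lebesgue (cball (0::'a) r) > 0" using content_cball_pos[OF r] by simp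
  have sq: "\<bar>y\<bar> powr 2 = y\<^sup>2" for y :: real by (simp add: powr_numeral)
  have "measure lebesgue (cball (0::'a) r) powr (1 - 2) * \<bar>\<integral>x. f x \<partial>lebesgue\<bar> powr 2
      \<le> (\<integral>x. \<bar>f x\<bar> powr 2 \<partial>lebesgue)"
    using L2_supported_integrable[OF f supp] L2_integrable_square[OF f] supp V
    by (intro Jensen_powr_supported) (auto simp: sq)
  then show ?thesis using V by (simp add: sq powr_minus field_simps)
qed

text \<open>The bridge from the L2 limits in \<open>energy_sol\<close> to limits of masses. A common
  radius along the filter keeps the volume factor of Cauchy-Schwarz fixed.\<close>

lemma L2_tendsto_integral:
  fixes g :: "'b \<Rightarrow> 'a::euclidean_space \<Rightarrow> real"
  assumes L2: "\<forall>\<^sub>F s in F. L2 (g s)" and supp: "\<forall>\<^sub>F s in F. AE x in lebesgue. x \<notin> cball 0 r \<longrightarrow> g s x = 0"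
    and r: "r > 0" and lim: "((\<lambda>s. \<integral>x. (g s x)\<^sup>2 \<partial>lebesgue) \<longlongrightarrow> 0) F"
  shows "((\<lambda>s. \<integral>x. g s x \<partial>lebesgue) \<longlongrightarrow> 0) F"
proof -
  have "((\<lambda>s. (\<integral>x. g s x \<partial>lebesgue)\<^sup>2) \<longlongrightarrow> 0) F"
  proof (rule tendsto_sandwich[OF _ _ tendsto_const])
    show "\<forall>\<^sub>F s in F. (\<integral>x. g s x \<partial>lebesgue)\<^sup>2
        \<le> measure lebesgue (cball (0::'a) r) * (\<integral>x. (g s x)\<^sup>2 \<partial>lebesgue)"
      using L2 supp by eventually_elim (rule L2_supported_integral_square_le[OF _ _ r])
    show "((\<lambda>s. measure lebesgue (cball (0::'a) r) * (\<integral>x. (g s x)\<^sup>2 \<partial>lebesgue)) \<longlongrightarrow> 0) F"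
      using tendsto_mult_right_zero[OF lim] by simp
  qed simp
  then have "((\<lambda>s. sqrt ((\<integral>x. g s x \<partial>lebesgue)\<^sup>2)) \<longlongrightarrow> 0) F"
    using tendsto_real_sqrt by fastforce
  then show ?thesis by (simp add: tendsto_rabs_zero_iff)
qed

section \<open>Differentiability and continuity of the mass\<close>

lemma at_within_Ico_neq_bot:
  fixes t T :: real
  assumes "t \<in> {0..<T}"
  shows "at t within {0..<T} \<noteq> bot"
proof -
  have "t islimpt {t<..<T}" using assms by (intro islimpt_greaterThanLessThan1) auto
  then have "t islimpt {0..<T}" by (rule islimpt_subset) (use assms in auto)
  then show ?thesis by (simp add: trivial_limit_within)
qed

text \<open>\<open>ut\<close> is known only as an L2 limit. Off the ball the difference quotients
  are 0, so their squared L2 distance to \<open>ut\<close> is at least the integral of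
  \<open>ut\<close> squared off the ball. That number does not depend on s, while the distance tends
  to 0.\<close>

lemma difference_quotient_support:
  fixes u ut :: "'a::euclidean_space \<Rightarrow> real \<Rightarrow> real"
  assumes t: "t \<in> {0..<T}"
    and u: "\<And>s. s \<in> {0..<T} \<Longrightarrow> L2 (\<lambda>x. u x s)" and ut: "L2 (\<lambda>x. ut x t)"
    and lim: "((\<lambda>s. \<integral>x. ((u x s - u x t) / (s - t) - ut x t)\<^sup>2 \<partial>lebesgue) \<longlongrightarrow> 0) (at t within {0..<T})"
    and supp: "\<And>s x. s \<in> {0..<T} \<Longrightarrow> x \<notin> cball 0 r \<Longrightarrow> u x s = 0"
  shows "AE x in lebesgue. x \<notin> cball 0 r \<longrightarrow> ut x t = 0"
proof -
  have int0: "integrable lebesgue (\<lambda>x. (ut x t)\<^sup>2 * indicator (- cball 0 r) x)"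
    using L2_integrable_square[OF ut] by (intro integrable_real_mult_indicator) auto
  have "(\<integral>x. (ut x t)\<^sup>2 * indicator (- cball 0 r) x \<partial>lebesgue) \<le> 0"
  proof (rule tendsto_lowerbound[OF lim _ at_within_Ico_neq_bot[OF t]])
    have "(\<integral>x. (ut x t)\<^sup>2 * indicator (- cball 0 r) x \<partial>lebesgue)
        \<le> (\<integral>x. ((u x s - u x t) / (s - t) - ut x t)\<^sup>2 \<partial>lebesgue)" if s: "s \<in> {0..<T}" for s
    proof (rule integral_mono[OF int0])
      have "L2 (\<lambda>x. (1 / (s - t)) * (u x s - u x t) - ut x t)"
        by (intro L2_diff L2_cmult u ut s t)
      from L2_integrable_square[OF this]
      show "integrable lebesgue (\<lambda>x. ((u x s - u x t) / (s - t) - ut x t)\<^sup>2)" by simp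
    qed (use supp[OF s] supp[OF t] in \<open>auto simp: indicator_def\<close>)
    then show "\<forall>\<^sub>F s in at t within {0..<T}. (\<integral>x. (ut x t)\<^sup>2 * indicator (- cball 0 r) x \<partial>lebesgue)
        \<le> (\<integral>x. ((u x s - u x t) / (s - t) - ut x t)\<^sup>2 \<partial>lebesgue)"
      by (simp add: eventually_at_filter)
  qed
  moreover have "0 \<le> (\<integral>x. (ut x t)\<^sup>2 * indicator (- cball 0 r) x \<partial>lebesgue)" by simp
  ultimately have "(\<integral>x. (ut x t)\<^sup>2 * indicator (- cball 0 r) x \<partial>lebesgue) = 0" by linarith
  then have "AE x in lebesgue. (ut x t)\<^sup>2 * indicator (- cball 0 r) x = 0"
    using integral_nonneg_eq_0_iff_AE[OF int0] by simp
  then show ?thesis by eventually_elim (auto simp: indicator_def)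
qed

lemma mass_has_derivative:
  fixes u ut :: "'a::euclidean_space \<Rightarrow> real \<Rightarrow> real"
  assumes t: "t \<in> {0..<T}" and r: "r > 0"
    and u: "\<And>s. s \<in> {0..<T} \<Longrightarrow> L2 (\<lambda>x. u x s)" and ut: "L2 (\<lambda>x. ut x t)"
    and lim: "((\<lambda>s. \<integral>x. ((u x s - u x t) / (s - t) - ut x t)\<^sup>2 \<partial>lebesgue) \<longlongrightarrow> 0) (at t within {0..<T})"
    and supp: "\<And>s x. s \<in> {0..<T} \<Longrightarrow> x \<notin> cball 0 r \<Longrightarrow> u x s = 0"
  shows "((\<lambda>t. \<integral>x. u x t \<partial>lebesgue) has_real_derivative (\<integral>x. ut x t \<partial>lebesgue)) (at t within {0..<T})"
proof -
  have supp_ut: "AE x in lebesgue. x \<notin> cball 0 r \<longrightarrow> ut x t = 0"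
    by (rule difference_quotient_support[where u = u and ut = ut and t = t and r = r, OF t u ut lim supp])
  have int_u: "integrable lebesgue (\<lambda>x. u x s)" if "s \<in> {0..<T}" for s
    using supp[OF that] by (intro L2_supported_integrable[OF u[OF that], of r]) auto
  have int_ut: "integrable lebesgue (\<lambda>x. ut x t)"
    by (rule L2_supported_integrable[OF ut supp_ut])
  have ev: "\<forall>\<^sub>F s in at t within {0..<T}. s \<in> {0..<T} \<and> s \<noteq> t"
    by (simp add: eventually_at_filter)
  have "((\<lambda>s. \<integral>x. ((u x s - u x t) / (s - t) - ut x t) \<partial>lebesgue) \<longlongrightarrow> 0) (at t within {0..<T})"
  proof (rule L2_tendsto_integral[OF _ _ r lim])
    have "L2 (\<lambda>x. (u x s - u x t) / (s - t) - ut x t)" if s: "s \<in> {0..<T}" for s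
    proof -
      have "L2 (\<lambda>x. (1 / (s - t)) * (u x s - u x t) - ut x t)"
        by (intro L2_diff L2_cmult u ut s t)
      then show ?thesis by simp
    qed
    then show "\<forall>\<^sub>F s in at t within {0..<T}. L2 (\<lambda>x. (u x s - u x t) / (s - t) - ut x t)"
      using ev by (auto elim: eventually_mono)
    have "AE x in lebesgue. x \<notin> cball 0 r \<longrightarrow> (u x s - u x t) / (s - t) - ut x t = 0"
      if s: "s \<in> {0..<T}" for s
      using supp_ut by eventually_elim (use supp[OF s] supp[OF t] in auto)
    then show "\<forall>\<^sub>F s in at t within {0..<T}. AE x in lebesgue. x \<notin> cball 0 r \<longrightarrow>
        (u x s - u x t) / (s - t) - ut x t = 0"
      using ev by (auto elim: eventually_mono)
  qed
  moreover have "\<forall>\<^sub>F s in at t within {0..<T}. (\<integral>x. ((u x s - u x t) / (s - t) - ut x t) \<partial>lebesgue)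
      = ((\<integral>x. u x s \<partial>lebesgue) - (\<integral>x. u x t \<partial>lebesgue)) / (s - t) - (\<integral>x. ut x t \<partial>lebesgue)"
    using ev by eventually_elim (use int_u int_ut t in simp)
  ultimately have "((\<lambda>s. ((\<integral>x. u x s \<partial>lebesgue) - (\<integral>x. u x t \<partial>lebesgue)) / (s - t) - (\<integral>x. ut x t \<partial>lebesgue)) \<longlongrightarrow> 0)
      (at t within {0..<T})"
    by (rule Lim_transform_eventually)
  then show ?thesis
    unfolding has_field_derivative_iff by (rule LIM_zero_cancel)
qed

lemma mass_continuous:
  fixes v :: "'a::euclidean_space \<Rightarrow> real \<Rightarrow> real"
  assumes r: "r > 0" and v: "\<And>s. s \<in> S \<Longrightarrow> L2 (\<lambda>x. v x s)"
    and lim: "\<And>t. t \<in> S \<Longrightarrow> ((\<lambda>s. \<integral>x. (v x s - v x t)\<^sup>2 \<partial>lebesgue) \<longlongrightarrow> 0) (at t within S)"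
    and supp: "\<And>s. s \<in> S \<Longrightarrow> AE x in lebesgue. x \<notin> cball 0 r \<longrightarrow> v x s = 0"
  shows "continuous_on S (\<lambda>t. \<integral>x. v x t \<partial>lebesgue)"
  unfolding continuous_on_def
proof
  fix t assume t: "t \<in> S"
  have ev: "\<forall>\<^sub>F s in at t within S. s \<in> S" by (simp add: eventually_at_filter)
  have int_v: "integrable lebesgue (\<lambda>x. v x s)" if "s \<in> S" for s
    by (rule L2_supported_integrable[OF v[OF that] supp[OF that]])
  have "((\<lambda>s. \<integral>x. v x s - v x t \<partial>lebesgue) \<longlongrightarrow> 0) (at t within S)"
  proof (rule L2_tendsto_integral[OF _ _ r lim[OF t]])
    show "\<forall>\<^sub>F s in at t within S. L2 (\<lambda>x. v x s - v x t)"
      using ev by eventually_elim (intro L2_diff v t)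
    have "AE x in lebesgue. x \<notin> cball 0 r \<longrightarrow> v x s - v x t = 0" if s: "s \<in> S" for s
      using supp[OF s] supp[OF t] by eventually_elim auto
    then show "\<forall>\<^sub>F s in at t within S. AE x in lebesgue. x \<notin> cball 0 r \<longrightarrow> v x s - v x t = 0"
      using ev by (auto elim: eventually_mono)
  qed
  moreover have "\<forall>\<^sub>F s in at t within S. (\<integral>x. v x s - v x t \<partial>lebesgue)
      = (\<integral>x. v x s \<partial>lebesgue) - (\<integral>x. v x t \<partial>lebesgue)"
    using ev by eventually_elim (use int_v t in simp)
  ultimately have "((\<lambda>s. (\<integral>x. v x s \<partial>lebesgue) - (\<integral>x. v x t \<partial>lebesgue)) \<longlongrightarrow> 0) (at t within S)"
    by (rule Lim_transform_eventually)
  then show "((\<lambda>s. \<integral>x. v x s \<partial>lebesgue) \<longlongrightarrow> (\<integral>x. v x t \<partial>lebesgue)) (at t within S)"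
    by (rule LIM_zero_cancel)
qed

section \<open>Test functions that factor into space and time\<close>

lemma pd_tensor:
  fixes X :: "'a::euclidean_space \<Rightarrow> real" and \<tau> :: "real \<Rightarrow> real"
  assumes "X differentiable (at x)" "\<tau> differentiable (at s)"
  shows "pd (\<lambda>z. X (fst z) * \<tau> (snd z)) v (x, s) = X x * pd \<tau> (snd v) s + pd X (fst v) x * \<tau> s"
proof -
  have X: "(X has_derivative frechet_derivative X (at x)) (at (fst (x, s)))"
    and \<tau>: "(\<tau> has_derivative frechet_derivative \<tau> (at s)) (at (snd (x, s)))"
    using assms by (simp_all add: frechet_derivative_works)
  have "((\<lambda>z. X (fst z)) has_derivative (\<lambda>v. frechet_derivative X (at x) (fst v))) (at (x, s))"
    by (rule has_derivative_compose[OF has_derivative_fst[OF has_derivative_ident] X])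
  moreover have "((\<lambda>z. \<tau> (snd z)) has_derivative (\<lambda>v. frechet_derivative \<tau> (at s) (snd v))) (at (x, s))"
    by (rule has_derivative_compose[OF has_derivative_snd[OF has_derivative_ident] \<tau>])
  ultimately have "((\<lambda>z. X (fst z) * \<tau> (snd z)) has_derivative
      (\<lambda>v. X (fst (x, s)) * frechet_derivative \<tau> (at s) (snd v)
         + frechet_derivative X (at x) (fst v) * \<tau> (snd (x, s)))) (at (x, s))"
    by (rule has_derivative_mult)
  from frechet_derivative_at[OF this, symmetric] show ?thesis by (simp add: pd_def)
qed

lemma pd_zero_direction:
  "f differentiable (at x) \<Longrightarrow> pd f 0 x = 0"
  unfolding pd_def by (rule linear_0[OF linear_frechet_derivative])

lemma test_fun_T_tensor:
  fixes X :: "'a::euclidean_space \<Rightarrow> real" and \<tau> :: "real \<Rightarrow> real"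
  assumes "smooth X" "smooth \<tau>" "\<And>x. x \<notin> cball 0 r \<Longrightarrow> X x = 0" "\<And>s. s \<notin> {a..d} \<Longrightarrow> \<tau> s = 0" "d < T"
  shows "test_fun_T T (\<lambda>z. X (fst z) * \<tau> (snd z))"
  unfolding test_fun_T_def
proof (intro conjI exI[of _ "cball 0 r \<times> {a..d}"] allI impI)
  show "smooth (\<lambda>z. X (fst z) * \<tau> (snd z))"
    by (intro smooth_mult smooth_compose_linear[OF bounded_linear_fst assms(1)]
        smooth_compose_linear[OF bounded_linear_snd assms(2)])
  show "compact (cball (0::'a) r \<times> {a..d})" by (intro compact_Times) auto
  fix z :: "'a \<times> real" assume "z \<notin> cball 0 r \<times> {a..d}"
  then show "X (fst z) * \<tau> (snd z) = 0" using assms(3,4) by (cases z) auto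
qed (use assms(5) in auto)

text \<open>On [0,k] the slope of the power is at most p k^(p-1), by the tangent inequality at the
  larger point, and truncating the absolute value at k is 1-Lipschitz.\<close>

lemma truncated_powr_lipschitz:
  fixes a b k p :: real
  assumes p: "p > 1" and k: "k \<ge> 0"
  shows "\<bar>min \<bar>a\<bar> k powr p - min \<bar>b\<bar> k powr p\<bar> \<le> p * k powr (p - 1) * \<bar>a - b\<bar>"
proof -
  have le: "y powr p - x powr p \<le> p * k powr (p - 1) * (y - x)" if "0 \<le> x" "x \<le> y" "y \<le> k" for x y
  proof -
    have "y powr p - x powr p \<le> p * y powr (p - 1) * (y - x)"
      using powr_tangent_le[OF p, of x y] that by (simp add: algebra_simps)
    also have "\<dots> \<le> p * k powr (p - 1) * (y - x)"
      using that p by (intro mult_right_mono mult_left_mono powr_mono2) auto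
    finally show ?thesis .
  qed
  define x y where "x = min \<bar>a\<bar> k" and "y = min \<bar>b\<bar> k"
  have xy: "0 \<le> x" "x \<le> k" "0 \<le> y" "y \<le> k" using k by (auto simp: x_def y_def)
  have "\<bar>x powr p - y powr p\<bar> \<le> p * k powr (p - 1) * \<bar>x - y\<bar>"
  proof (cases "x \<le> y")
    case True
    then show ?thesis using le[of x y] xy powr_mono2[of p x y] p by simp
  next
    case False
    then show ?thesis using le[of y x] xy powr_mono2[of p y x] p by simp
  qed
  also have "\<dots> \<le> p * k powr (p - 1) * \<bar>a - b\<bar>"
    using p by (intro mult_left_mono) (auto simp: x_def y_def min_def)
  finally show ?thesis by (simp add: x_def y_def)
qed

text \<open>
  The Bochner integral over \<open>s\<close> in the weak formulation is 0 if its integrand is not Borel in \<open>s\<close>, and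
  here each slice \<open>u(\<cdot>,s)\<close> is an arbitrary representative. Truncating \<open>\<bar>u\<bar>\<close> at height \<open>k\<close> makes the
  mass of the power continuous in \<open>s\<close>, because the truncated power is Lipschitz.
\<close>

lemma borel_measurable_power_mass:
  fixes u :: "'a::euclidean_space \<Rightarrow> real \<Rightarrow> real"
  assumes p: "p > 1" and r: "r > 0" and u: "\<And>s. s \<in> S \<Longrightarrow> L2 (\<lambda>x. u x s)"
    and lim: "\<And>t. t \<in> S \<Longrightarrow> ((\<lambda>s. \<integral>x. (u x s - u x t)\<^sup>2 \<partial>lebesgue) \<longlongrightarrow> 0) (at t within S)"
    and supp: "\<And>s x. s \<in> S \<Longrightarrow> x \<notin> cball 0 r \<Longrightarrow> u x s = 0"
  shows "(\<lambda>s. \<integral>\<^sup>+x. ennreal (\<bar>u x s\<bar> powr p) \<partial>lebesgue) \<in> borel_measurable (restrict_space borel S)"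
proof -
  define P where "P k s = (\<integral>x. min \<bar>u x s\<bar> (real k) powr p \<partial>lebesgue)" for k :: nat and s
  have meas: "(\<lambda>x. u x s) \<in> borel_measurable lebesgue" if "s \<in> S" for s
    using L2_measurable[OF u[OF that]] .
  have int_u: "integrable lebesgue (\<lambda>x. u x s)" if "s \<in> S" for s
    using supp[OF that] by (intro L2_supported_integrable[OF u[OF that], of r]) auto
  have int_P: "integrable lebesgue (\<lambda>x. min \<bar>u x s\<bar> (real k) powr p)" if s: "s \<in> S" for k s
  proof (rule Bochner_Integration.integrable_bound)
    show "integrable lebesgue (\<lambda>x. p * real k powr (p - 1) * \<bar>u x s\<bar>)"
      using int_u[OF s] by simp
    show "(\<lambda>x. min \<bar>u x s\<bar> (real k) powr p) \<in> borel_measurable lebesgue"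
      using meas[OF s] by measurable
    show "AE x in lebesgue. norm (min \<bar>u x s\<bar> (real k) powr p) \<le> norm (p * real k powr (p - 1) * \<bar>u x s\<bar>)"
      using truncated_powr_lipschitz[OF p, of "real k" _ 0] p by (simp add: abs_mult)
  qed
  have "continuous_on S (P k)" for k
    unfolding continuous_on_def
  proof
    fix t assume t: "t \<in> S"
    have ev: "\<forall>\<^sub>F s in at t within S. s \<in> S" by (simp add: eventually_at_filter)
    have L1: "((\<lambda>s. \<integral>x. \<bar>u x s - u x t\<bar> \<partial>lebesgue) \<longlongrightarrow> 0) (at t within S)"
    proof (rule L2_tendsto_integral[OF _ _ r])
      have "L2 (\<lambda>x. \<bar>u x s - u x t\<bar>)" if "s \<in> S" for s
        using L2_diff[OF u[OF that] u[OF t]] by (auto simp: L2_def)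
      then show "\<forall>\<^sub>F s in at t within S. L2 (\<lambda>x. \<bar>u x s - u x t\<bar>)"
        using ev by (auto elim: eventually_mono)
      show "\<forall>\<^sub>F s in at t within S. AE x in lebesgue. x \<notin> cball 0 r \<longrightarrow> \<bar>u x s - u x t\<bar> = 0"
        using ev by eventually_elim (use supp supp[OF t] in simp)
      show "((\<lambda>s. \<integral>x. \<bar>u x s - u x t\<bar>\<^sup>2 \<partial>lebesgue) \<longlongrightarrow> 0) (at t within S)"
        using lim[OF t] by simp
    qed
    have "((\<lambda>s. P k s - P k t) \<longlongrightarrow> 0) (at t within S)"
    proof (rule Lim_null_comparison)
      have "norm (P k s - P k t) \<le> p * real k powr (p - 1) * (\<integral>x. \<bar>u x s - u x t\<bar> \<partial>lebesgue)"
        if s: "s \<in> S" for s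
      proof -
        have "P k s - P k t = (\<integral>x. (min \<bar>u x s\<bar> (real k) powr p - min \<bar>u x t\<bar> (real k) powr p) \<partial>lebesgue)"
          using int_P[OF s] int_P[OF t] by (simp add: P_def)
        also have "norm \<dots> \<le> (\<integral>x. norm (min \<bar>u x s\<bar> (real k) powr p - min \<bar>u x t\<bar> (real k) powr p) \<partial>lebesgue)"
          by (rule integral_norm_bound)
        also have "\<dots> \<le> (\<integral>x. p * real k powr (p - 1) * \<bar>u x s - u x t\<bar> \<partial>lebesgue)"
          using int_P[OF s] int_P[OF t] int_u[OF s] int_u[OF t] truncated_powr_lipschitz[OF p]
          by (intro integral_mono) auto
        finally show ?thesis by simp
      qed
      then show "\<forall>\<^sub>F s in at t within S. norm (P k s - P k t)
          \<le> p * real k powr (p - 1) * (\<integral>x. \<bar>u x s - u x t\<bar> \<partial>lebesgue)"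
        using ev by (auto elim: eventually_mono)
      show "((\<lambda>s. p * real k powr (p - 1) * (\<integral>x. \<bar>u x s - u x t\<bar> \<partial>lebesgue)) \<longlongrightarrow> 0) (at t within S)"
        using tendsto_mult_right_zero[OF L1] by simp
    qed
    then show "(P k \<longlongrightarrow> P k t) (at t within S)" by (rule LIM_zero_cancel)
  qed
  then have P_meas: "P k \<in> borel_measurable (restrict_space borel S)" for k
    by (rule borel_measurable_continuous_on_restrict)
  \<comment> \<open>With nonnegative integrals, monotone convergence applies at every time,
    including those whose untruncated power is not integrable.\<close>
  have SUP: "(\<integral>\<^sup>+x. ennreal (\<bar>u x s\<bar> powr p) \<partial>lebesgue) = (SUP k. ennreal (P k s))" if s: "s \<in> S" for s
  proof -
    have "(SUP k. ennreal (min \<bar>y\<bar> (real k) powr p)) = ennreal (\<bar>y\<bar> powr p)" for y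
    proof (rule antisym)
      show "(SUP k. ennreal (min \<bar>y\<bar> (real k) powr p)) \<le> ennreal (\<bar>y\<bar> powr p)"
        using p by (intro SUP_least ennreal_leI powr_mono2) auto
      obtain k where "\<bar>y\<bar> \<le> real k" using real_arch_simple by blast
      then have "ennreal (\<bar>y\<bar> powr p) = ennreal (min \<bar>y\<bar> (real k) powr p)" by (simp add: min_def)
      also have "\<dots> \<le> (SUP k. ennreal (min \<bar>y\<bar> (real k) powr p))" by (rule SUP_upper) simp
      finally show "ennreal (\<bar>y\<bar> powr p) \<le> (SUP k. ennreal (min \<bar>y\<bar> (real k) powr p))" .
    qed
    then have "(\<integral>\<^sup>+x. ennreal (\<bar>u x s\<bar> powr p) \<partial>lebesgue)
        = (\<integral>\<^sup>+x. (SUP k. ennreal (min \<bar>u x s\<bar> (real k) powr p)) \<partial>lebesgue)" by simp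
    also have "\<dots> = (SUP k. \<integral>\<^sup>+x. ennreal (min \<bar>u x s\<bar> (real k) powr p) \<partial>lebesgue)"
    proof (rule nn_integral_monotone_convergence_SUP)
      show "incseq (\<lambda>k x. ennreal (min \<bar>u x s\<bar> (real k) powr p))"
        using p by (auto simp: incseq_def le_fun_def intro!: ennreal_leI powr_mono2)
      show "(\<lambda>x. ennreal (min \<bar>u x s\<bar> (real k) powr p)) \<in> borel_measurable lebesgue" for k
        using meas[OF s] by measurable
    qed
    also have "\<dots> = (SUP k. ennreal (P k s))"
      unfolding P_def using int_P[OF s] by (subst nn_integral_eq_integral) auto
    finally show ?thesis .
  qed
  have "(\<lambda>s. SUP k. ennreal (P k s)) \<in> borel_measurable (restrict_space borel S)"
    by (intro borel_measurable_SUP measurable_compose[OF P_meas measurable_ennreal]) auto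
  then show ?thesis
    by (subst measurable_cong[where g = "\<lambda>s. SUP k. ennreal (P k s)"]) (auto simp: space_restrict_space SUP)
qed

text \<open>Tonelli's theorem across a completion: the hypothesis concerns Lebesgue measure on
  space-time, the product theorem Borel functions. The integrand is therefore replaced by a Borel
  function g equal to it off a Borel null set Q, almost all of whose time slices are null.\<close>

lemma power_mass_integrable:
  fixes u :: "'a::euclidean_space \<Rightarrow> real \<Rightarrow> real"
  assumes p: "p > 1" and r: "r > 0" and S: "{a..b} \<subseteq> S" and u: "\<And>s. s \<in> S \<Longrightarrow> L2 (\<lambda>x. u x s)"
    and lim: "\<And>t. t \<in> S \<Longrightarrow> ((\<lambda>s. \<integral>x. (u x s - u x t)\<^sup>2 \<partial>lebesgue) \<longlongrightarrow> 0) (at t within S)"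
    and supp: "\<And>s x. s \<in> S \<Longrightarrow> x \<notin> cball 0 r \<Longrightarrow> u x s = 0"
    and int: "set_integrable lebesgue (cball 0 r \<times> {a..b}) (\<lambda>z. \<bar>u (fst z) (snd z)\<bar> powr p)"
  shows "set_integrable lborel {a..b} (\<lambda>s. \<integral>x. \<bar>u x s\<bar> powr p \<partial>lebesgue)"
    and "AE s in lborel. s \<in> {a..b} \<longrightarrow> integrable lebesgue (\<lambda>x. \<bar>u x s\<bar> powr p)"
proof -
  define N where "N s = (\<integral>\<^sup>+x. ennreal (\<bar>u x s\<bar> powr p) \<partial>lebesgue)" for s
  define f where "f z = indicator (cball 0 r \<times> {a..b}) z *\<^sub>R (\<bar>u (fst z) (snd z)\<bar> powr p)" for z
  have meas: "(\<lambda>x. \<bar>u x s\<bar> powr p) \<in> borel_measurable lebesgue" if "s \<in> S" for s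
    using L2_measurable[OF u[OF that]] by measurable
  have "N \<in> borel_measurable (restrict_space borel S)"
    unfolding N_def by (rule borel_measurable_power_mass[OF p r u lim supp])
  then have "N \<in> borel_measurable (restrict_space borel {a..b})"
    using S by (rule measurable_restrict_mono)
  then have N_meas: "(\<lambda>s. N s * indicator {a..b} s) \<in> borel_measurable lborel"
    by (simp add: borel_measurable_restrict_space_iff_ennreal)
  have f: "integrable lebesgue f"
    using int by (simp add: set_integrable_def f_def[abs_def])
  then obtain g where g: "g \<in> borel_measurable lborel" "AE z in lborel. f z = g z"
    using completion_ex_borel_measurable_real borel_measurable_integrable by blast
  have g_pair: "g \<in> borel_measurable (lborel \<Otimes>\<^sub>M lborel)"
    using g(1) by (simp add: lborel_prod)
  obtain Q where Q: "Q \<in> null_sets lborel" "{z. f z \<noteq> g z} \<subseteq> Q"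
    using g(2) by (auto elim!: AE_E simp: null_sets_def)
  have fg: "f z = g z" if "z \<notin> Q" for z
    using Q(2) that by blast
  have "AE z in lborel \<Otimes>\<^sub>M lborel. z \<notin> Q"
    using AE_not_in[OF Q(1)] unfolding lborel_prod .
  then have "AE x in lborel. AE s in lborel. (x, s) \<notin> Q"
    by (rule lborel_pair.AE_pair)
  \<comment> \<open>The slices wanted are those at fixed s, so the almost-everywhere quantifiers are
    exchanged, for which Q has to be Borel.\<close>
  then have "AE s in lborel. AE x in lborel. (x, s) \<notin> Q"
  proof (subst (asm) lborel_pair.AE_commute)
    show "{z \<in> space (lborel \<Otimes>\<^sub>M lborel). (fst z, snd z) \<notin> Q} \<in> sets (lborel \<Otimes>\<^sub>M lborel)"
    proof -
      have "{z \<in> space (lborel \<Otimes>\<^sub>M lborel). (fst z, snd z) \<notin> Q} = - Q"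
        by (auto simp: space_pair_measure)
      moreover have "- Q \<in> sets (lborel \<Otimes>\<^sub>M lborel)"
        using Q(1) unfolding lborel_prod by (auto simp: null_sets_def)
      ultimately show ?thesis by simp
    qed
  qed
  then have slice: "AE s in lborel. N s * indicator {a..b} s = (\<integral>\<^sup>+x. ennreal (g (x, s)) \<partial>lborel)"
  proof eventually_elim
    fix s assume s: "AE x in lborel. (x, s) \<notin> Q"
    have "N s * indicator {a..b} s = (\<integral>\<^sup>+x. ennreal (f (x, s)) \<partial>lebesgue)"
    proof (cases "s \<in> {a..b}")
      case True
      then have "ennreal (\<bar>u x s\<bar> powr p) = ennreal (f (x, s))" for x
        using supp[of s x] S p by (auto simp: f_def indicator_def)
      then show ?thesis using True by (simp add: N_def)
    qed (simp add: f_def)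
    also have "\<dots> = (\<integral>\<^sup>+x. ennreal (f (x, s)) \<partial>lborel)" by (rule nn_integral_completion)
    also have "\<dots> = (\<integral>\<^sup>+x. ennreal (g (x, s)) \<partial>lborel)"
    proof (rule nn_integral_cong_AE)
      show "AE x in lborel. ennreal (f (x, s)) = ennreal (g (x, s))"
        using s by (rule eventually_mono) (rule arg_cong[OF fg])
    qed
    finally show "N s * indicator {a..b} s = (\<integral>\<^sup>+x. ennreal (g (x, s)) \<partial>lborel)" .
  qed
  have "(\<integral>\<^sup>+s. N s * indicator {a..b} s \<partial>lborel) = (\<integral>\<^sup>+s. (\<integral>\<^sup>+x. ennreal (g (x, s)) \<partial>lborel) \<partial>lborel)"
    by (rule nn_integral_cong_AE[OF slice])
  also have "\<dots> = (\<integral>\<^sup>+z. ennreal (g z) \<partial>(lborel \<Otimes>\<^sub>M lborel))"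
    using g_pair by (subst lborel_pair.nn_integral_snd[symmetric]) auto
  also have "\<dots> = (\<integral>\<^sup>+z. ennreal (f z) \<partial>lborel)"
    unfolding lborel_prod using g(2) by (intro nn_integral_cong_AE) (auto elim!: eventually_mono)
  also have "\<dots> = (\<integral>\<^sup>+z. ennreal (f z) \<partial>lebesgue)" by (rule nn_integral_completion[symmetric])
  also have "\<dots> < \<infinity>"
    using f by (simp add: integrable_iff_bounded f_def)
  finally have finite: "(\<integral>\<^sup>+s. N s * indicator {a..b} s \<partial>lborel) < \<infinity>" .
  have "AE s in lborel. N s * indicator {a..b} s \<noteq> \<infinity>"
    using finite by (intro nn_integral_PInf_AE N_meas) auto
  then show "AE s in lborel. s \<in> {a..b} \<longrightarrow> integrable lebesgue (\<lambda>x. \<bar>u x s\<bar> powr p)"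
  proof eventually_elim
    fix s assume s: "N s * indicator {a..b} s \<noteq> \<infinity>"
    show "s \<in> {a..b} \<longrightarrow> integrable lebesgue (\<lambda>x. \<bar>u x s\<bar> powr p)"
    proof
      assume "s \<in> {a..b}"
      then have "s \<in> S" "N s < \<infinity>" using S s by (auto simp: less_top)
      then show "integrable lebesgue (\<lambda>x. \<bar>u x s\<bar> powr p)"
        using meas[of s] by (auto simp: integrable_iff_bounded N_def)
    qed
  qed
  \<comment> \<open>The default values agree: the Bochner integral of a non-integrable slice is 0,
    and \<open>enn2real\<close> sends infinity to 0.\<close>
  have P_eq: "indicator {a..b} s *\<^sub>R (\<integral>x. \<bar>u x s\<bar> powr p \<partial>lebesgue) = enn2real (N s * indicator {a..b} s)" for s
    using meas[of s] S by (cases "s \<in> {a..b}") (auto simp: N_def integral_eq_nn_integral)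
  show "set_integrable lborel {a..b} (\<lambda>s. \<integral>x. \<bar>u x s\<bar> powr p \<partial>lebesgue)"
    unfolding set_integrable_def P_eq
  proof (rule integrableI_nonneg)
    show "(\<lambda>s. enn2real (N s * indicator {a..b} s)) \<in> borel_measurable lborel"
      using N_meas by measurable
    have "(\<integral>\<^sup>+s. ennreal (enn2real (N s * indicator {a..b} s)) \<partial>lborel) \<le> (\<integral>\<^sup>+s. N s * indicator {a..b} s \<partial>lborel)"
    proof (rule nn_integral_mono)
      show "ennreal (enn2real y) \<le> y" for y by (cases y) auto
    qed
    then show "(\<integral>\<^sup>+s. ennreal (enn2real (N s * indicator {a..b} s)) \<partial>lborel) < \<infinity>"
      using finite by (rule le_less_trans)
  qed simp
qed

section \<open>From the weak formulation to the mass\<close>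

lemma H1_with_tendsto_L2:
  fixes u :: "'a::euclidean_space \<Rightarrow> real \<Rightarrow> real" and Du :: "'a \<Rightarrow> real \<Rightarrow> 'a"
  assumes t: "t \<in> S" and H1: "\<And>s. s \<in> S \<Longrightarrow> H1_with (\<lambda>x. u x s) (\<lambda>x. Du x s)"
    and lim: "((\<lambda>s. \<integral>x. (u x s - u x t)\<^sup>2 + (norm (Du x s - Du x t))\<^sup>2 \<partial>lebesgue) \<longlongrightarrow> 0) (at t within S)"
  shows "((\<lambda>s. \<integral>x. (u x s - u x t)\<^sup>2 \<partial>lebesgue) \<longlongrightarrow> 0) (at t within S)"
proof (rule tendsto_sandwich[OF _ _ tendsto_const lim])
  have le: "(\<integral>x. (u x s - u x t)\<^sup>2 \<partial>lebesgue) \<le> (\<integral>x. (u x s - u x t)\<^sup>2 + (norm (Du x s - Du x t))\<^sup>2 \<partial>lebesgue)"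
    if s: "s \<in> S" for s
  proof (rule integral_mono)
    show "integrable lebesgue (\<lambda>x. (u x s - u x t)\<^sup>2)"
      using H1[OF s] H1[OF t] by (intro L2_integrable_square L2_diff) (auto simp: H1_with_def)
    \<comment> \<open>A non-integrable gradient part would give the larger integral the default
      value 0; the coordinatewise L2 bounds exclude this.\<close>
    have "integrable lebesgue (\<lambda>x. \<Sum>i\<in>Basis. (Du x s \<bullet> i - Du x t \<bullet> i)\<^sup>2)"
      using H1[OF s] H1[OF t]
      by (intro Bochner_Integration.integrable_sum L2_integrable_square L2_diff) (auto simp: H1_with_def)
    moreover have "(\<Sum>i\<in>Basis. (Du x s \<bullet> i - Du x t \<bullet> i)\<^sup>2) = (norm (Du x s - Du x t))\<^sup>2" for x
      unfolding power2_norm_eq_inner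
      by (subst euclidean_inner) (simp add: inner_diff_left power2_eq_square)
    ultimately show "integrable lebesgue (\<lambda>x. (u x s - u x t)\<^sup>2 + (norm (Du x s - Du x t))\<^sup>2)"
      using \<open>integrable lebesgue (\<lambda>x. (u x s - u x t)\<^sup>2)\<close> by simp
  qed simp
  then show "\<forall>\<^sub>F s in at t within S. (\<integral>x. (u x s - u x t)\<^sup>2 \<partial>lebesgue)
      \<le> (\<integral>x. (u x s - u x t)\<^sup>2 + (norm (Du x s - Du x t))\<^sup>2 \<partial>lebesgue)"
    by (simp add: eventually_at_filter)
qed simp

text \<open>X equals 1 on a ball exceeding the support by a margin of 1. Multiplication by X
  therefore changes nothing, the derivatives of X vanish near the support, and every spatial
  integral collapses to a mass times \<tau> or its derivative.\<close>

lemma tensor_weak_terms: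
  fixes u ut :: "'a::euclidean_space \<Rightarrow> real" and G :: "'a \<Rightarrow> 'a" and X :: "'a \<Rightarrow> real" and \<tau> :: "real \<Rightarrow> real"
  assumes X: "smooth X" "\<And>x. x \<in> cball 0 (r + 1) \<Longrightarrow> X x = 1" "\<And>x. x \<notin> cball 0 r' \<Longrightarrow> X x = 0"
    and \<tau>: "smooth \<tau>" and r: "r > 0"
    and u: "H1_with u G" "\<And>x. x \<notin> cball 0 r \<Longrightarrow> u x = 0"
    and ut: "L2 ut" "AE x in lebesgue. x \<notin> cball 0 r \<longrightarrow> ut x = 0"
    and \<phi>: "\<phi> = (\<lambda>z. X (fst z) * \<tau> (snd z))"
  shows "(\<integral>x. ut x * \<phi> (x, s) \<partial>lebesgue) = \<tau> s * (\<integral>x. ut x \<partial>lebesgue)"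
    and "(\<integral>x. - ut x * pd \<phi> (0, 1) (x, s) + (\<Sum>i\<in>Basis. (G x \<bullet> i) * pd \<phi> (i, 0) (x, s)) \<partial>lebesgue)
        = - pd \<tau> 1 s * (\<integral>x. ut x \<partial>lebesgue)"
    and "(\<integral>x. (b * ut x - q * u x) * \<phi> (x, s) \<partial>lebesgue)
        = \<tau> s * (b * (\<integral>x. ut x \<partial>lebesgue) - q * (\<integral>x. u x \<partial>lebesgue))"
    and "(\<integral>x. \<bar>u x\<bar> powr p * \<phi> (x, s) \<partial>lebesgue) = \<tau> s * (\<integral>x. \<bar>u x\<bar> powr p \<partial>lebesgue)"
proof -
  have L2u: "L2 u" using u(1) by (simp add: H1_with_def)
  have contX: "continuous_on UNIV X" by (rule smooth_continuous[OF X(1)])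
  have L2X: "L2 X" by (rule L2_continuous_compact_support[OF contX X(3)])
  have X1: "X x = 1" if "x \<in> cball 0 r" for x using that by (intro X(2)) auto
  have int_u: "integrable lebesgue u" using u(2) by (intro L2_supported_integrable[OF L2u, of r]) auto
  have int_ut: "integrable lebesgue ut" by (rule L2_supported_integrable[OF ut])
  have ut_X: "(\<integral>x. ut x * X x \<partial>lebesgue) = (\<integral>x. ut x \<partial>lebesgue)"
  proof (rule integral_cong_AE)
    show "AE x in lebesgue. ut x * X x = ut x"
      using ut(2) by eventually_elim (use X1 in force)
  qed (use L2_measurable[OF ut(1)] L2_measurable[OF L2X] in auto)
  have u_X: "u x * X x = u x" for x using u(2)[of x] X1[of x] by (cases "x \<in> cball 0 r") auto
  show "(\<integral>x. ut x * \<phi> (x, s) \<partial>lebesgue) = \<tau> s * (\<integral>x. ut x \<partial>lebesgue)"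
  proof -
    have "(\<lambda>x. ut x * \<phi> (x, s)) = (\<lambda>x. \<tau> s * (ut x * X x))" by (simp add: \<phi> mult_ac)
    then show ?thesis by (simp add: ut_X)
  qed
  show "(\<integral>x. (b * ut x - q * u x) * \<phi> (x, s) \<partial>lebesgue)
        = \<tau> s * (b * (\<integral>x. ut x \<partial>lebesgue) - q * (\<integral>x. u x \<partial>lebesgue))"
  proof -
    have "(\<lambda>x. (b * ut x - q * u x) * \<phi> (x, s)) = (\<lambda>x. \<tau> s * (b * (ut x * X x) - q * u x))"
    proof
      fix x
      have "(b * ut x - q * u x) * \<phi> (x, s) = \<tau> s * (b * (ut x * X x) - q * (u x * X x))"
        by (simp add: \<phi> algebra_simps)
      then show "(b * ut x - q * u x) * \<phi> (x, s) = \<tau> s * (b * (ut x * X x) - q * u x)"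
        by (simp only: u_X)
    qed
    then show ?thesis
      using L2_mult_integrable[OF ut(1) L2X] int_u by (simp add: ut_X)
  qed
  show "(\<integral>x. \<bar>u x\<bar> powr p * \<phi> (x, s) \<partial>lebesgue) = \<tau> s * (\<integral>x. \<bar>u x\<bar> powr p \<partial>lebesgue)"
  proof -
    have "\<bar>u x\<bar> powr p * \<phi> (x, s) = \<tau> s * \<bar>u x\<bar> powr p" for x
      using u(2)[of x] X1[of x] by (cases "x \<in> cball 0 r") (auto simp: \<phi>)
    then show ?thesis by (simp only: integral_mult_right_zero)
  qed
  have pd_inside: "pd X i x = 0" if "x \<in> ball 0 (r + 1)" for i x
    by (rule pd_eq_0_on_open[of "ball 0 (r + 1)" _ 1]) (use that X(2) in auto)
  have pd_outside: "pd X i x = 0" if "x \<notin> cball 0 r'" for i x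
    by (rule pd_eq_0_on_open[of "- cball 0 r'" _ 0]) (use that X(3) in auto)
  have pd_pd: "pd (pd X i) i x = 0" if "x \<in> ball 0 (r + 1)" for i x
    by (rule pd_eq_0_on_open[of "ball 0 (r + 1)" _ 0]) (use that pd_inside in auto)
  have L2_pd: "L2 (pd X i)" for i
    by (rule L2_continuous_compact_support[OF smooth_continuous[OF smooth_pd[OF X(1)]] pd_outside])
  \<comment> \<open>Nothing is known about where the weak gradient vanishes. Testing it with the
    i-th derivative of X moves the integral onto \<open>u\<close> times a second derivative of X,
    and the latter is 0 on the support of \<open>u\<close>.\<close>
  have grad: "(\<integral>x. (G x \<bullet> i) * pd X i x \<partial>lebesgue) = 0" if i: "i \<in> Basis" for i
  proof -
    have "test_fun (pd X i)"
      unfolding test_fun_def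
      by (intro conjI exI[of _ "cball 0 r'"] allI impI smooth_pd X(1) compact_cball pd_outside)
    then have "(\<integral>x. u x * pd (pd X i) i x \<partial>lebesgue) = - (\<integral>x. (G x \<bullet> i) * pd X i x \<partial>lebesgue)"
      using u(1) i by (auto simp: H1_with_def weak_grad_def)
    moreover have "u x * pd (pd X i) i x = 0" for x
      using u(2)[of x] pd_pd[of x i] by (cases "x \<in> cball 0 r") auto
    ultimately show ?thesis by simp
  qed
  have int_grad: "integrable lebesgue (\<lambda>x. (G x \<bullet> i) * pd X i x)" if "i \<in> Basis" for i
    using u(1) that by (intro L2_mult_integrable L2_pd) (auto simp: H1_with_def)
  have pd_t: "pd \<phi> (0, 1) (x, s) = X x * pd \<tau> 1 s" for x
    unfolding \<phi> using smooth_differentiable[OF X(1)] smooth_differentiable[OF \<tau>]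
    by (simp add: pd_tensor pd_zero_direction)
  have pd_x: "pd \<phi> (i, 0) (x, s) = pd X i x * \<tau> s" for i x
    unfolding \<phi> using smooth_differentiable[OF X(1)] smooth_differentiable[OF \<tau>]
    by (simp add: pd_tensor pd_zero_direction)
  show "(\<integral>x. - ut x * pd \<phi> (0, 1) (x, s) + (\<Sum>i\<in>Basis. (G x \<bullet> i) * pd \<phi> (i, 0) (x, s)) \<partial>lebesgue)
        = - pd \<tau> 1 s * (\<integral>x. ut x \<partial>lebesgue)"
  proof -
    have "(\<lambda>x. - ut x * pd \<phi> (0, 1) (x, s) + (\<Sum>i\<in>Basis. (G x \<bullet> i) * pd \<phi> (i, 0) (x, s)))
        = (\<lambda>x. - pd \<tau> 1 s * (ut x * X x) + (\<Sum>i\<in>Basis. \<tau> s * ((G x \<bullet> i) * pd X i x)))"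
      by (simp add: pd_t pd_x mult_ac)
    then have "(\<integral>x. - ut x * pd \<phi> (0, 1) (x, s) + (\<Sum>i\<in>Basis. (G x \<bullet> i) * pd \<phi> (i, 0) (x, s)) \<partial>lebesgue)
        = (\<integral>x. - pd \<tau> 1 s * (ut x * X x) + (\<Sum>i\<in>Basis. \<tau> s * ((G x \<bullet> i) * pd X i x)) \<partial>lebesgue)"
      by (simp only:)
    also have "\<dots> = - pd \<tau> 1 s * (\<integral>x. ut x * X x \<partial>lebesgue)
        + (\<Sum>i\<in>Basis. \<tau> s * (\<integral>x. (G x \<bullet> i) * pd X i x \<partial>lebesgue))"
      using L2_mult_integrable[OF ut(1) L2X] int_grad
      by (subst Bochner_Integration.integral_add)
         (auto intro!: Bochner_Integration.integrable_sum simp: Bochner_Integration.integral_sum)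
    finally show ?thesis using grad by (simp add: ut_X)
  qed
qed

text \<open>The integrability of f and g is a conclusion: \<epsilon> f and \<epsilon> g agree almost
  everywhere with the solution and its time derivative at time 0, which are square integrable and
  supported in a ball. The coefficient \<open>k\<close> is the volume of the ball of radius t + R to
  the power 1 - p.\<close>

lemma energy_sol_ode_super:
  fixes f g :: "'a::euclidean_space \<Rightarrow> real" and u :: "'a \<Rightarrow> real \<Rightarrow> real"
  assumes p: "p > 1" and R: "R \<ge> 1" and T: "T > 0" and \<epsilon>: "\<epsilon> > 0"
    and meas: "f \<in> borel_measurable lebesgue" "g \<in> borel_measurable lebesgue"
    and sol: "energy_sol \<mu>1 \<mu>2 \<alpha> \<beta> p f g \<epsilon> T u"
    and supp: "\<forall>t\<in>{0..<T}. \<forall>x. norm x > t + R \<longrightarrow> u x t = 0"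
  defines "q \<equiv> \<lambda>t. \<mu>2 / (1 + t) powr (\<alpha> + 1)" and "b \<equiv> \<lambda>t. \<mu>1 / (1 + t) powr \<beta>"
    and "k \<equiv> \<lambda>t. unit_ball_vol (real DIM('a)) powr (1 - p) * (t + R) powr (- (real DIM('a) * (p - 1)))"
  shows "integrable lebesgue f \<and> integrable lebesgue g \<and>
    (\<exists>U A. ode_super T b (power_source q k p) U A
      \<and> U 0 = \<epsilon> * (\<integral>x. f x \<partial>lebesgue) \<and> A 0 = \<epsilon> * (\<integral>x. g x \<partial>lebesgue))"
proof -
  obtain ut Du where
    "\<forall>t\<in>{0..<T}. H1_with (\<lambda>x. u x t) (\<lambda>x. Du x t)"
    "\<forall>t\<in>{0..<T}. ((\<lambda>s. \<integral>x. (u x s - u x t)^2 + (norm (Du x s - Du x t))^2 \<partial>lebesgue)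
                      \<longlongrightarrow> 0) (at t within {0..<T})"
    "\<forall>t\<in>{0..<T}. L2 (\<lambda>x. ut x t)"
    "\<forall>t\<in>{0..<T}. ((\<lambda>s. \<integral>x. ((u x s - u x t) / (s - t) - ut x t)^2 \<partial>lebesgue)
                      \<longlongrightarrow> 0) (at t within {0..<T})"
    "\<forall>t\<in>{0..<T}. ((\<lambda>s. \<integral>x. (ut x s - ut x t)^2 \<partial>lebesgue) \<longlongrightarrow> 0) (at t within {0..<T})"
    "\<forall>K. compact K \<and> K \<subseteq> UNIV \<times> {0<..<T} \<longrightarrow>
          set_integrable lebesgue K (\<lambda>z. \<bar>u (fst z) (snd z)\<bar> powr p)"
    and u0: "AE x in lebesgue. u x 0 = \<epsilon> * f x" and ut0: "AE x in lebesgue. ut x 0 = \<epsilon> * g x"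
    and weak': "\<forall>\<phi> t. test_fun_T T \<phi> \<and> t \<in> {0..<T} \<longrightarrow>
        (\<integral>x. ut x t * \<phi> (x, t) \<partial>lebesgue)
        - (\<integral>x. \<epsilon> * g x * \<phi> (x, 0) \<partial>lebesgue)
        + (LINT s:{0..t}|lborel. \<integral>x. - ut x s * pd \<phi> (0, 1) (x, s)
             + (\<Sum>i\<in>Basis. (Du x s \<bullet> i) * pd \<phi> (i, 0) (x, s)) \<partial>lebesgue)
        + (LINT s:{0..t}|lborel. \<integral>x. (\<mu>1 / (1 + s) powr \<beta> * ut x s
             - \<mu>2 / (1 + s) powr (\<alpha> + 1) * u x s) * \<phi> (x, s) \<partial>lebesgue)
        = (LINT s:{0..t}|lborel. \<integral>x. \<bar>u x s\<bar> powr p * \<phi> (x, s) \<partial>lebesgue)"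
  proof -
    show thesis
      using sol unfolding energy_sol_def by (elim exE conjE) (rule that, assumption+)
  qed
  note H1 = bspec[OF this(1)] and limH1 = bspec[OF this(2)] and L2ut = bspec[OF this(3)]
    and limq = bspec[OF this(4)] and limut = bspec[OF this(5)]
    and Lp = mp[OF spec[OF this(6)] conjI]
  note weak = mp[OF spec[OF spec[OF weak']] conjI]
  \<comment> \<open>One ball containing the support at all times before T, used for the regularity
    statements.\<close>
  define r where "r = T + R"
  have r: "r > 0" using T R by (simp add: r_def)
  have supp_u: "u x s = 0" if "s \<in> {0..<T}" "x \<notin> cball 0 r" for x s
    using supp that by (auto simp: r_def)
  have L2u: "L2 (\<lambda>x. u x s)" if "s \<in> {0..<T}" for s
    using H1[OF that] by (simp add: H1_with_def)
  have limu: "((\<lambda>s. \<integral>x. (u x s - u x t)\<^sup>2 \<partial>lebesgue) \<longlongrightarrow> 0) (at t within {0..<T})" if "t \<in> {0..<T}" for t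
    by (rule H1_with_tendsto_L2[OF that H1 limH1[OF that]])
  have supp_ut: "AE x in lebesgue. x \<notin> cball 0 r \<longrightarrow> ut x t = 0" if "t \<in> {0..<T}" for t
    by (rule difference_quotient_support[where u = u and ut = ut and t = t and r = r,
          OF that L2u L2ut[OF that] limq[OF that] supp_u])
  define U A where "U t = (\<integral>x. u x t \<partial>lebesgue)" and "A t = (\<integral>x. ut x t \<partial>lebesgue)" for t
  have derivU: "(U has_real_derivative A t) (at t within {0..<T})" if "t \<in> {0..<T}" for t
    unfolding U_def[abs_def] A_def
    by (rule mass_has_derivative[where u = u and ut = ut and t = t and r = r,
          OF that r L2u L2ut[OF that] limq[OF that] supp_u])
  have contA: "continuous_on {0..<T} A"
    unfolding A_def[abs_def] by (rule mass_continuous[where v = ut and r = r, OF r L2ut limut supp_ut])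
  have contU: "continuous_on {0..<T} U"
    unfolding continuous_on_eq_continuous_within using DERIV_continuous[OF derivU] by blast
  have contb: "continuous_on {0..<T} b" and contq: "continuous_on {0..<T} q" and contk: "continuous_on {0..<T} k"
    unfolding b_def q_def k_def using R by (auto intro!: continuous_intros)
  have contUp: "continuous_on {0..<T} (\<lambda>s. \<bar>U s\<bar> powr p)"
    using p by (intro continuous_on_powr' continuous_intros contU) auto
  define P where "P s = (\<integral>x. \<bar>u x s\<bar> powr p \<partial>lebesgue)" for s
  have increment: "integral {t1..t2} (\<lambda>s. power_source q k p s (U s) - b s * A s) \<le> A t2 - A t1"
    if t: "0 < t1" "t1 < t2" "t2 < T" for t1 t2
  proof -
    define e where "e = (T - t2) / 3"
    have e: "e > 0" "t2 + 2 * e < T" using t by (auto simp: e_def field_simps)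
    have "r + 1 > 0" using r by simp
    then obtain X :: "'a \<Rightarrow> real" where X: "smooth X" "\<And>x. x \<in> cball 0 (r + 1) \<Longrightarrow> X x = 1"
      "\<And>x. x \<notin> cball 0 (r + 1 + 1) \<Longrightarrow> X x = 0"
      using ex_spatial_cutoff[where 'a = 'a] by metis
    \<comment> \<open>\<open>\<tau>\<close> vanishes near 0: integrability of \<open>\<bar>u\<bar> powr p\<close> is only assumed away from time 0.\<close>
    obtain \<tau> where \<tau>: "smooth \<tau>" "\<And>s. s \<in> {t1 / 2..t2 + e} \<Longrightarrow> \<tau> s = (1::real)"
      "\<And>s. s \<notin> {t1 / 3..t2 + 2 * e} \<Longrightarrow> \<tau> s = 0"
      using ex_temporal_cutoff[of "t1 / 3" "t1 / 2" "t2 + e" "t2 + 2 * e"] t e by auto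
    define \<phi> where "\<phi> = (\<lambda>z. X (fst z) * \<tau> (snd z))"
    have test: "test_fun_T T \<phi>"
      unfolding \<phi>_def by (rule test_fun_T_tensor[OF X(1) \<tau>(1) X(3) \<tau>(3) e(2)])
    have terms: "(\<integral>x. ut x s * \<phi> (x, s) \<partial>lebesgue) = \<tau> s * A s"
      "(\<integral>x. - ut x s * pd \<phi> (0, 1) (x, s) + (\<Sum>i\<in>Basis. (Du x s \<bullet> i) * pd \<phi> (i, 0) (x, s)) \<partial>lebesgue)
        = - pd \<tau> 1 s * A s"
      "(\<integral>x. (\<mu>1 / (1 + s) powr \<beta> * ut x s - \<mu>2 / (1 + s) powr (\<alpha> + 1) * u x s) * \<phi> (x, s) \<partial>lebesgue)
        = \<tau> s * (b s * A s - q s * U s)"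
      "(\<integral>x. \<bar>u x s\<bar> powr p * \<phi> (x, s) \<partial>lebesgue) = \<tau> s * P s"
      if s: "s \<in> {0..<T}" for s
    proof -
      note * = tensor_weak_terms[where X = X and \<tau> = \<tau> and r = r and r' = "r + 1 + 1" and u = "\<lambda>x. u x s"
          and ut = "\<lambda>x. ut x s" and G = "\<lambda>x. Du x s" and \<phi> = \<phi> and s = s,
          OF X(1) X(2) X(3) \<tau>(1) r H1[OF s] supp_u[OF s] L2ut[OF s] supp_ut[OF s] \<phi>_def]
      show "(\<integral>x. ut x s * \<phi> (x, s) \<partial>lebesgue) = \<tau> s * A s"
        unfolding A_def by (rule *(1))
      show "(\<integral>x. - ut x s * pd \<phi> (0, 1) (x, s) + (\<Sum>i\<in>Basis. (Du x s \<bullet> i) * pd \<phi> (i, 0) (x, s)) \<partial>lebesgue)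
        = - pd \<tau> 1 s * A s"
        unfolding A_def by (rule *(2))
      show "(\<integral>x. (\<mu>1 / (1 + s) powr \<beta> * ut x s - \<mu>2 / (1 + s) powr (\<alpha> + 1) * u x s) * \<phi> (x, s) \<partial>lebesgue)
        = \<tau> s * (b s * A s - q s * U s)"
        unfolding A_def U_def b_def q_def by (rule *(3))
      show "(\<integral>x. \<bar>u x s\<bar> powr p * \<phi> (x, s) \<partial>lebesgue) = \<tau> s * P s"
        unfolding P_def by (rule *(4))
    qed
    define D where "D = pd \<tau> 1"
    have contD: "continuous_on S D" for S
      unfolding D_def using smooth_continuous[OF smooth_pd[OF \<tau>(1)]] continuous_on_subset by blast
    have cont\<tau>: "continuous_on S \<tau>" for S
      using smooth_continuous[OF \<tau>(1)] continuous_on_subset by blast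
    have D0: "D s = 0" if "s \<in> {t1..t2}" for s
      unfolding D_def by (rule pd_eq_0_on_open[of "{t1 / 2<..<t2 + e}" _ 1]) (use that t e \<tau>(2) in auto)
    have \<tau>0: "\<tau> 0 = 0" using \<tau>(3)[of 0] t by simp
    define G1 G2 where "G1 s = - D s * A s" and "G2 s = \<tau> s * (b s * A s - q s * U s)" for s
    have contG: "continuous_on {0..<T} G1" "continuous_on {0..<T} G2"
      unfolding G1_def G2_def by (intro continuous_intros contD cont\<tau> contA contb contq contU)+
    have P_int: "set_integrable lborel {t1 / 3..t2} P"
      and P_AE: "AE s in lborel. s \<in> {t1 / 3..t2} \<longrightarrow> integrable lebesgue (\<lambda>x. \<bar>u x s\<bar> powr p)"
    proof -
      have K: "compact (cball (0::'a) r \<times> {t1 / 3..t2})" "cball (0::'a) r \<times> {t1 / 3..t2} \<subseteq> UNIV \<times> {0<..<T}"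
        using t by (auto intro: compact_Times)
      have S: "{t1 / 3..t2} \<subseteq> {0..<T}" using t by auto
      show "set_integrable lborel {t1 / 3..t2} P"
        unfolding P_def[abs_def]
        by (rule power_mass_integrable(1)[where u = u and S = "{0..<T}", OF p r S L2u limu supp_u Lp[OF K]])
      show "AE s in lborel. s \<in> {t1 / 3..t2} \<longrightarrow> integrable lebesgue (\<lambda>x. \<bar>u x s\<bar> powr p)"
        by (rule power_mass_integrable(2)[where u = u and S = "{0..<T}", OF p r S L2u limu supp_u Lp[OF K]])
    qed
    \<comment> \<open>Integrability of P is available on [t1/3, t2] only; \<tau> vanishes on the
      rest of [0, t2].\<close>
    have H_int: "set_integrable lborel {0..t2} (\<lambda>s. \<tau> s * P s)"
    proof -
      have "bounded (\<tau> ` {0..t2})"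
        by (intro compact_imp_bounded compact_continuous_image cont\<tau>) auto
      then obtain C where C: "C > 0" "\<And>s. s \<in> {0..t2} \<Longrightarrow> \<bar>\<tau> s\<bar> \<le> C"
        by (auto simp: bounded_pos)
      have eq: "indicator {0..t2} s *\<^sub>R (\<tau> s * P s) = \<tau> s * (indicator {t1 / 3..t2} s *\<^sub>R P s)" for s
        using \<tau>(3)[of s] t by (auto simp: indicator_def)
      show ?thesis
        unfolding set_integrable_def eq
      proof (rule Bochner_Integration.integrable_bound)
        have P': "integrable lborel (\<lambda>s. indicator {t1 / 3..t2} s *\<^sub>R P s)"
          using P_int by (simp add: set_integrable_def)
        then show "integrable lborel (\<lambda>s. C * (indicator {t1 / 3..t2} s *\<^sub>R P s))" by simp
        have "\<tau> \<in> borel_measurable lborel"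
          using borel_measurable_continuous_onI[OF cont\<tau>] by simp
        then show "(\<lambda>s. \<tau> s * (indicator {t1 / 3..t2} s *\<^sub>R P s)) \<in> borel_measurable lborel"
          using borel_measurable_integrable[OF P'] by (rule borel_measurable_times)
        have "norm (\<tau> s * (indicator {t1 / 3..t2} s *\<^sub>R P s)) \<le> norm (C * (indicator {t1 / 3..t2} s *\<^sub>R P s))" for s
          using C(1) C(2)[of s] t by (auto simp: indicator_def abs_mult intro!: mult_right_mono)
        then show "AE s in lborel. norm (\<tau> s * (indicator {t1 / 3..t2} s *\<^sub>R P s))
            \<le> norm (C * (indicator {t1 / 3..t2} s *\<^sub>R P s))" by simp
      qed
    qed
    \<comment> \<open>Subtracting the identity at \<open>t1\<close> from the one at
      \<open>t2\<close> leaves integrals over [t1, t2], where \<tau> is 1 and its derivative 0. The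
      datum g drops out because \<tau> vanishes at time 0.\<close>
    have balance: "\<tau> t * A t + integral {0..t} G1 + integral {0..t} G2 = integral {0..t} (\<lambda>s. \<tau> s * P s)"
      if "t \<in> {t1, t2}" for t
    proof -
      have t': "t \<in> {0..<T}" "t \<le> t2" "{0..t} \<subseteq> {0..<T}" using that \<open>0 < t1\<close> \<open>t1 < t2\<close> \<open>t2 < T\<close> by auto
      have "(LINT s:{0..t}|lborel. \<integral>x. - ut x s * pd \<phi> (0, 1) (x, s)
             + (\<Sum>i\<in>Basis. (Du x s \<bullet> i) * pd \<phi> (i, 0) (x, s)) \<partial>lebesgue) = (LINT s:{0..t}|lborel. G1 s)"
        using terms(2) t' by (intro set_lebesgue_integral_cong) (auto simp: G1_def D_def)
      also have "\<dots> = integral {0..t} G1"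
        by (intro set_borel_integral_eq_integral borel_integrable_atLeastAtMost' continuous_on_subset[OF contG(1)] t')
      moreover have "(LINT s:{0..t}|lborel. \<integral>x. (\<mu>1 / (1 + s) powr \<beta> * ut x s
             - \<mu>2 / (1 + s) powr (\<alpha> + 1) * u x s) * \<phi> (x, s) \<partial>lebesgue) = (LINT s:{0..t}|lborel. G2 s)"
        using terms(3) t' by (intro set_lebesgue_integral_cong) (auto simp: G2_def)
      moreover have "\<dots> = integral {0..t} G2"
        by (intro set_borel_integral_eq_integral borel_integrable_atLeastAtMost' continuous_on_subset[OF contG(2)] t')
      moreover have "(LINT s:{0..t}|lborel. \<integral>x. \<bar>u x s\<bar> powr p * \<phi> (x, s) \<partial>lebesgue) = (LINT s:{0..t}|lborel. \<tau> s * P s)"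
        using terms(4) t' by (intro set_lebesgue_integral_cong) auto
      moreover have "\<dots> = integral {0..t} (\<lambda>s. \<tau> s * P s)"
        by (intro set_borel_integral_eq_integral set_integrable_subset[OF H_int]) (use t' in auto)
      moreover have "(\<integral>x. \<epsilon> * g x * \<phi> (x, 0) \<partial>lebesgue) = 0" by (simp add: \<phi>_def \<tau>0)
      ultimately show ?thesis using weak[OF test t'(1)] terms(1)[OF t'(1)] by simp
    qed
    have comb: "integral {0..t2} h = integral {0..t1} h + integral {t1..t2} h"
      if "h integrable_on {0..t2}" for h :: "real \<Rightarrow> real"
      using Henstock_Kurzweil_Integration.integral_combine[OF _ _ that, of t1] t by simp
    have G_int: "G1 integrable_on {0..t2}" "G2 integrable_on {0..t2}"
      by (intro integrable_continuous_real continuous_on_subset[OF contG(1)] continuous_on_subset[OF contG(2)];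
          use t in auto)+
    have H_int': "(\<lambda>s. \<tau> s * P s) integrable_on {0..t2}"
      by (rule set_borel_integral_eq_integral(1)[OF H_int])
    have \<tau>1: "\<tau> s = 1" if "s \<in> {t1..t2}" for s using that t e by (intro \<tau>(2)) auto
    have "A t2 - A t1 = integral {t1..t2} (\<lambda>s. \<tau> s * P s) - integral {t1..t2} G1 - integral {t1..t2} G2"
      using balance[of t1] balance[of t2] comb[OF G_int(1)] comb[OF G_int(2)] comb[OF H_int'] \<tau>1 t by simp
    also have "integral {t1..t2} (\<lambda>s. \<tau> s * P s) = integral {t1..t2} P"
      by (rule integral_cong) (simp add: \<tau>1)
    also have "integral {t1..t2} G1 = integral {t1..t2} (\<lambda>_. 0)"
      by (rule integral_cong) (simp add: G1_def D0)
    also have "integral {t1..t2} G2 = integral {t1..t2} (\<lambda>s. b s * A s - q s * U s)"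
      by (rule integral_cong) (simp add: G2_def \<tau>1)
    finally have A_eq: "A t2 - A t1 = integral {t1..t2} P - integral {t1..t2} (\<lambda>s. b s * A s - q s * U s)" by simp
    have sub12: "{t1..t2} \<subseteq> {0..<T}" using t by auto
    note cont12 = continuous_on_subset[OF contA sub12] continuous_on_subset[OF contU sub12]
      continuous_on_subset[OF contb sub12] continuous_on_subset[OF contq sub12]
      continuous_on_subset[OF contk sub12] continuous_on_subset[OF contUp sub12]
    have P12: "set_integrable lborel {t1..t2} P"
      by (rule set_integrable_subset[OF P_int]) (use t in auto)
    have kU: "set_integrable lborel {t1..t2} (\<lambda>s. k s * \<bar>U s\<bar> powr p)"
      by (intro borel_integrable_atLeastAtMost' continuous_intros cont12)
    \<comment> \<open>The ball of radius s + R at time s, in place of the fixed ball of radius r,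
      keeps the constant independent of T and produces the decay of \<open>k\<close>.\<close>
    have Jensen: "k s * \<bar>U s\<bar> powr p \<le> P s"
      if s: "s \<in> {t1..t2}" and int: "integrable lebesgue (\<lambda>x. \<bar>u x s\<bar> powr p)" for s
    proof -
      have s0: "s \<in> {0..<T}" "s + R > 0" using s t R by auto
      have vol: "measure lebesgue (cball (0::'a) (s + R)) = unit_ball_vol (real DIM('a)) * (s + R) ^ DIM('a)"
        using content_cball[of "s + R" "0::'a"] s0 by simp
      have "measure lebesgue (cball (0::'a) (s + R)) powr (1 - p) = k s"
        unfolding vol k_def using s0
        by (simp add: powr_mult powr_powr algebra_simps flip: powr_realpow)
      moreover have "measure lebesgue (cball (0::'a) (s + R)) powr (1 - p) * \<bar>\<integral>x. u x s \<partial>lebesgue\<bar> powr p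
          \<le> (\<integral>x. \<bar>u x s\<bar> powr p \<partial>lebesgue)"
      proof (rule Jensen_powr_supported[OF p _ _ _ int])
        show "measure lebesgue (cball (0::'a) (s + R)) > 0"
          using content_cball_pos[OF s0(2)] by simp
        show "integrable lebesgue (\<lambda>x. u x s)"
          using supp_u[OF s0(1)] by (intro L2_supported_integrable[OF L2u[OF s0(1)], of r]) auto
        show "AE x in lebesgue. x \<notin> cball 0 (s + R) \<longrightarrow> u x s = 0"
          using supp s0 by auto
      qed simp
      ultimately show ?thesis by (simp add: U_def P_def)
    qed
    \<comment> \<open>The pointwise inequality holds only at almost every time, so the integrals are
      compared as Lebesgue integrals before returning to gauge integrals.\<close>
    have "(LINT s:{t1..t2}|lborel. k s * \<bar>U s\<bar> powr p) \<le> (LINT s:{t1..t2}|lborel. P s)"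
      unfolding set_lebesgue_integral_def
    proof (rule integral_mono_AE)
      show "AE s in lborel. indicator {t1..t2} s *\<^sub>R (k s * \<bar>U s\<bar> powr p) \<le> indicator {t1..t2} s *\<^sub>R P s"
        using P_AE by eventually_elim (use Jensen t in \<open>auto simp: indicator_def\<close>)
    qed (use P12 kU in \<open>auto simp: set_integrable_def\<close>)
    then have "integral {t1..t2} (\<lambda>s. k s * \<bar>U s\<bar> powr p) \<le> integral {t1..t2} P"
      using set_borel_integral_eq_integral(2)[OF P12] set_borel_integral_eq_integral(2)[OF kU] by simp
    moreover have "integral {t1..t2} (\<lambda>s. power_source q k p s (U s) - b s * A s)
        = integral {t1..t2} (\<lambda>s. k s * \<bar>U s\<bar> powr p - (b s * A s - q s * U s))"
      by (rule integral_cong) (simp add: power_source_def)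
    moreover have "\<dots> = integral {t1..t2} (\<lambda>s. k s * \<bar>U s\<bar> powr p) - integral {t1..t2} (\<lambda>s. b s * A s - q s * U s)"
      by (intro Henstock_Kurzweil_Integration.integral_diff integrable_continuous_real continuous_intros cont12)
    ultimately show ?thesis using A_eq by linarith
  qed
  have zero: "0 \<in> {0..<T}" using T by simp
  have "integrable lebesgue (\<lambda>x. u x 0)"
    using supp_u[OF zero] by (intro L2_supported_integrable[OF L2u[OF zero], of r]) auto
  moreover have "integrable lebesgue (\<lambda>x. ut x 0)"
    by (rule L2_supported_integrable[OF L2ut[OF zero] supp_ut[OF zero]])
  moreover have data: "integrable lebesgue h \<and> (\<integral>x. v x \<partial>lebesgue) = \<epsilon> * (\<integral>x. h x \<partial>lebesgue)"
    if v: "integrable lebesgue v" "AE x in lebesgue. v x = \<epsilon> * h x" and h: "h \<in> borel_measurable lebesgue"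
    for v h :: "'a \<Rightarrow> real"
  proof -
    have "integrable lebesgue (\<lambda>x. \<epsilon> * h x)"
      using v h by (subst integrable_cong_AE[symmetric, where f = v]) auto
    moreover have "(\<integral>x. v x \<partial>lebesgue) = (\<integral>x. \<epsilon> * h x \<partial>lebesgue)"
      using v h by (intro integral_cong_AE) auto
    ultimately show ?thesis using \<epsilon> by simp
  qed
  ultimately have "integrable lebesgue f \<and> U 0 = \<epsilon> * (\<integral>x. f x \<partial>lebesgue)"
    "integrable lebesgue g \<and> A 0 = \<epsilon> * (\<integral>x. g x \<partial>lebesgue)"
    using data[OF _ u0 meas(1)] data[OF _ ut0 meas(2)] by (auto simp: U_def A_def)
  moreover have "ode_super T b (power_source q k p) U A"
    unfolding ode_super_def using derivU contA increment by blast
  ultimately show ?thesis by blast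
qed

section \<open>The lifespan bound\<close>

theorem theorem2p1:
  fixes f g :: "'a::euclidean_space \<Rightarrow> real" and \<mu>1 \<mu>2 \<alpha> \<beta> p R :: real
  assumes "\<mu>1 \<ge> 0" and "\<mu>2 > 0" and "\<alpha> < 1" and "\<beta> > 1" and "p > 1"
    and "H1 f" and "L2 g"
    and "AE x in lebesgue. f x \<ge> 0" and "AE x in lebesgue. g x \<ge> 0"
    and "\<not> ((AE x in lebesgue. f x = 0) \<and> (AE x in lebesgue. g x = 0))"
    and "R \<ge> 1"
  shows "\<exists>\<epsilon>0>0. \<exists>C>0. \<forall>\<epsilon> T u. 0 < \<epsilon> \<and> \<epsilon> \<le> \<epsilon>0 \<and> T > 0
           \<and> energy_sol \<mu>1 \<mu>2 \<alpha> \<beta> p f g \<epsilon> T u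
           \<and> (\<forall>t\<in>{0..<T}. \<forall>x. norm x > t + R \<longrightarrow> u x t = 0)
           \<longrightarrow> T \<le> 3 * zeta DIM('a) p \<mu>1 \<mu>2 \<alpha> \<beta> (C * \<epsilon>)"
proof (cases "\<exists>\<epsilon> T u. 0 < \<epsilon> \<and> T > 0 \<and> energy_sol \<mu>1 \<mu>2 \<alpha> \<beta> p f g \<epsilon> T u
           \<and> (\<forall>t\<in>{0..<T}. \<forall>x. norm x > t + R \<longrightarrow> u x t = 0)")
  \<comment> \<open>The masses of f and g enter the constants, but their integrability comes from
    the existence of one solution for some \<epsilon>. Without any such solution all constants will
    do.\<close>
  case False
  then have "\<forall>\<epsilon> T u. \<not> (0 < \<epsilon> \<and> T > 0 \<and> energy_sol \<mu>1 \<mu>2 \<alpha> \<beta> p f g \<epsilon> T u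
      \<and> (\<forall>t\<in>{0..<T}. \<forall>x. norm x > t + R \<longrightarrow> u x t = 0))" by blast
  then show ?thesis by (intro exI[of _ 1] conjI) (simp, simp, blast)
next
  case True
  note \<mu>1 = assms(1) and \<mu>2 = assms(2) and \<alpha> = assms(3) and \<beta> = assms(4) and p = assms(5) and R = assms(11)
  have meas: "f \<in> borel_measurable lebesgue" "g \<in> borel_measurable lebesgue"
    using assms(6,7) by (auto simp: H1_def H1_with_def L2_def)
  define \<kappa> N where "\<kappa> = unit_ball_vol (real DIM('a)) powr (1 - p)" and "N = real DIM('a) * (p - 1)"
  define E where "E = 2 / (p - 1) - real DIM('a) + (1 + \<alpha>) / 4"
  define u0 u1 where "u0 = (\<integral>x. f x \<partial>lebesgue)" and "u1 = (\<integral>x. g x \<partial>lebesgue)"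
  have int: "integrable lebesgue f" "integrable lebesgue g"
    using True energy_sol_ode_super[OF p R _ _ meas] by blast+
  have u: "0 \<le> u0" "0 \<le> u1" "0 < u0 \<or> 0 < u1"
  proof -
    show nonneg: "0 \<le> u0" "0 \<le> u1"
      unfolding u0_def u1_def using assms(8,9) by (auto intro: integral_nonneg_AE)
    have "\<not> (u0 = 0 \<and> u1 = 0)"
      using assms(10) integral_nonneg_eq_0_iff_AE[OF int(1) assms(8)]
        integral_nonneg_eq_0_iff_AE[OF int(2) assms(9)] by (simp add: u0_def u1_def)
    then show "0 < u0 \<or> 0 < u1" using nonneg by linarith
  qed
  have \<kappa>N: "\<kappa> > 0" "N \<ge> 0" using p by (auto simp: \<kappa>_def N_def less_imp_neq[OF unit_ball_vol_pos, symmetric])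
  obtain Z where Z: "Z > 0" and lifespan: "\<And>\<epsilon> z T U A. 0 < \<epsilon> \<and> Z \<le> z \<and>
      \<epsilon> * z powr E * exp (2 / (1 - \<alpha>) * sqrt (\<mu>2 * exp (\<mu>1 / (1 - \<beta>))) * z powr ((1 - \<alpha>) / 2)) = 1 \<and>
      ode_super T (\<lambda>t. \<mu>1 / (1 + t) powr \<beta>) (power_source (\<lambda>t. \<mu>2 / (1 + t) powr (\<alpha> + 1))
        (\<lambda>t. \<kappa> * (t + R) powr (- N)) p) U A \<and> U 0 = \<epsilon> * u0 \<and> A 0 = \<epsilon> * u1 \<Longrightarrow> T \<le> 3 * z"
    using ode_lifespan[OF \<mu>1 \<mu>2 \<alpha> \<beta> p \<kappa>N R u, of E] by blast
  \<comment> \<open>For these \<epsilon> the value of \<open>zeta\<close> is a true root beyond the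
    threshold Z, which is what \<open>lifespan\<close> asks of z.\<close>
  obtain \<epsilon>0 where \<epsilon>0: "\<epsilon>0 > 0" "\<And>\<epsilon>. 0 < \<epsilon> \<and> \<epsilon> \<le> \<epsilon>0 \<Longrightarrow> Z \<le> zeta DIM('a) p \<mu>1 \<mu>2 \<alpha> \<beta> \<epsilon> \<and>
     \<epsilon> * zeta DIM('a) p \<mu>1 \<mu>2 \<alpha> \<beta> \<epsilon> powr E * exp (2 / (1 - \<alpha>) * sqrt (\<mu>2 * exp (\<mu>1 / (1 - \<beta>)))
        * zeta DIM('a) p \<mu>1 \<mu>2 \<alpha> \<beta> \<epsilon> powr ((1 - \<alpha>) / 2)) = 1"
    using zeta_large[OF \<mu>2 \<alpha> Z, of "DIM('a)" p \<mu>1 \<beta>] unfolding E_def by blast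
  have "T \<le> 3 * zeta DIM('a) p \<mu>1 \<mu>2 \<alpha> \<beta> (1 * \<epsilon>)"
    if sol: "0 < \<epsilon> \<and> \<epsilon> \<le> \<epsilon>0 \<and> T > 0 \<and> energy_sol \<mu>1 \<mu>2 \<alpha> \<beta> p f g \<epsilon> T u
           \<and> (\<forall>t\<in>{0..<T}. \<forall>x. norm x > t + R \<longrightarrow> u x t = 0)" for \<epsilon> T u
  proof -
    from sol obtain U A where
      "ode_super T (\<lambda>t. \<mu>1 / (1 + t) powr \<beta>) (power_source (\<lambda>t. \<mu>2 / (1 + t) powr (\<alpha> + 1))
        (\<lambda>t. \<kappa> * (t + R) powr (- N)) p) U A" "U 0 = \<epsilon> * u0" "A 0 = \<epsilon> * u1"
      using energy_sol_ode_super[OF p R _ _ meas, of T \<epsilon> \<mu>1 \<mu>2 \<alpha> \<beta> u]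
      unfolding \<kappa>_def N_def u0_def u1_def by blast
    then have "T \<le> 3 * zeta DIM('a) p \<mu>1 \<mu>2 \<alpha> \<beta> \<epsilon>"
      using \<epsilon>0(2)[of \<epsilon>] sol by (intro lifespan[of \<epsilon> _ T U A]) auto
    then show "T \<le> 3 * zeta DIM('a) p \<mu>1 \<mu>2 \<alpha> \<beta> (1 * \<epsilon>)" by simp
  qed
  then show ?thesis using \<epsilon>0(1) zero_less_one by blast
qed

end
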